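(* Consider a heterogeneous random key graph $\mathbb{G}(n,\overrightarrow{a}, \overrightarrow{K_n},P_n)$ (defined in the context) with $P_n = \Omega(n)$ and $$\omega\big(\sqrt{P_n/n}\,\big) = K_{1,n} \leq K_{2,n}\leq \ldots \leq K_{m,n} = o\big(\sqrt{P_n}\,\big).$$ Define the sequence $\beta_n$ for all $n$ by $$\sum_{j=1}^{m} \left\{ a_j \left[1 -\frac{\binom{P_n-K_{1,n}}{K_{j,n}}}{\binom{P_n}{K_{j,n}}}\right] \right\} = \frac{\ln n + \beta_n}{n}.$$ Then $$\lim_{n\to\infty}\mathbb{P}\big[\mathbb{G}(n,\overrightarrow{a}, \overrightarrow{K_n},P_n)\text{ is connected}\big] = \begin{cases} 0, & \text{if } \lim_{n\to\infty}\beta_n = -\infty,\\ 1, & \text{if } \lim_{n\to\infty}\beta_n = \infty.\end{cases}$$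
   Context: Heterogeneous random key graph $\mathbb{G}(n,\overrightarrow{a}, \overrightarrow{K_n},P_n)$: Let $m$ be a fixed positive integer and $\overrightarrow{a}=(a_1,\dots,a_m)$ a fixed vector of positive constants (not depending on $n$) with $\sum_{i=1}^m a_i=1$; let $\overrightarrow{K_n}=(K_{1,n},\dots,K_{m,n})$ be positive integers with $1\le K_{i,n}\le P_n$, and let $\mathcal{P}_n$ be a pool of $P_n$ distinct keys. The graph has node set $\mathcal{V}_n=\{v_1,\dots,v_n\}$. Each node is independently assigned to exactly one of $m$ groups $\mathcal{A}_1,\dots,\mathcal{A}_m$, with $\mathbb{P}[v\in\mathcal{A}_i]=a_i$. Each node in group $\mathcal{A}_i$ then independently chooses a set of $K_{i,n}$ distinct keys uniformly at random among all $K_{i,n}$-subsets of $\mathcal{P}_n$. Two distinct nodes are joined by an undirected edge if and only if their key sets share at least one key. All limits are as $n\to\infty$; $o,O,\omega,\Omega$ are standard asymptotic notation. *)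

theory Defs
  imports
    "HOL-Probability.Probability"
    "HOL-Library.Landau_Symbols"
    "Graph_Theory.Graph_Theory"
begin

definition group_pmf :: "nat \<Rightarrow> (nat \<Rightarrow> real) \<Rightarrow> nat pmf" where
  "group_pmf m a = embed_pmf (\<lambda>i. if i \<in> {1..m} then a i else 0)"

text \<open>The value of \<open>embed_pmf\<close> is meaningful only for nonnegative weights of total mass 1:\<close>

lemma pmf_group_pmf:
  assumes "\<And>i. i \<in> {1..m} \<Longrightarrow> 0 < a i" and "(\<Sum>i = 1..m. a i) = 1"
  shows "pmf (group_pmf m a) i = (if i \<in> {1..m} then a i else 0)"
  unfolding group_pmf_def
proof (rule pmf_embed_pmf)
  show "0 \<le> (if i \<in> {1..m} then a i else 0)" for i
    using assms(1) by (simp add: less_imp_le)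
  have "(\<integral>\<^sup>+ i. ennreal (if i \<in> {1..m} then a i else 0) \<partial>count_space UNIV)
      = (\<integral>\<^sup>+ i. ennreal (a i) * indicator {1..m} i \<partial>count_space UNIV)"
    by (rule nn_integral_cong) (simp split: split_indicator)
  also have "\<dots> = (\<integral>\<^sup>+ i. ennreal (a i) \<partial>count_space {1..m})"
    by (simp add: nn_integral_count_space_indicator)
  also have "\<dots> = (\<Sum>i = 1..m. ennreal (a i))"
    by (rule nn_integral_count_space_finite) simp
  also have "\<dots> = ennreal (\<Sum>i = 1..m. a i)"
    using assms(1) by (intro sum_ennreal) (simp add: less_imp_le)
  finally show "(\<integral>\<^sup>+ i. ennreal (if i \<in> {1..m} then a i else 0) \<partial>count_space UNIV) = 1"
    using assms(2) by simp
qed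

definition key_sets :: "nat \<Rightarrow> nat \<Rightarrow> nat set set" where
  "key_sets P k = {S. S \<subseteq> {..<P} \<and> card S = k}"

lemma finite_key_sets: "finite (key_sets P k)"
  by (simp add: key_sets_def)

lemma card_key_sets: "card (key_sets P k) = P choose k"
  unfolding key_sets_def by (subst n_subsets) simp_all

lemma key_sets_nonempty: "k \<le> P \<Longrightarrow> key_sets P k \<noteq> {}"
  by (metis card_key_sets card.empty binomial_eq_0_iff not_less)

definition node_keys_pmf :: "nat \<Rightarrow> (nat \<Rightarrow> real) \<Rightarrow> (nat \<Rightarrow> nat) \<Rightarrow> nat \<Rightarrow> nat set pmf" where
  "node_keys_pmf m a K P = bind_pmf (group_pmf m a) (\<lambda>i. pmf_of_set (key_sets P (K i)))"

definition key_graph :: "'v set \<Rightarrow> ('v \<Rightarrow> 'k set) \<Rightarrow> 'v pair_pre_digraph" where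
  "key_graph V S =
    \<lparr> pverts = V, parcs = {(u, v). u \<in> V \<and> v \<in> V \<and> u \<noteq> v \<and> S u \<inter> S v \<noteq> {}} \<rparr>"

text \<open>An undirected graph is represented by its symmetric digraph.\<close>

lemma pair_graph_key_graph: "finite V \<Longrightarrow> pair_graph (key_graph V S)"
  by unfold_locales
    (auto simp: key_graph_def symmetric_def intro!: symI
      intro: finite_subset[of _ "V \<times> V"])

definition het_random_key_graph ::
    "nat \<Rightarrow> nat \<Rightarrow> (nat \<Rightarrow> real) \<Rightarrow> (nat \<Rightarrow> nat) \<Rightarrow> nat \<Rightarrow> nat pair_pre_digraph pmf" where
  "het_random_key_graph n m a K P =
    map_pmf (key_graph {1..n}) (Pi_pmf {1..n} {} (\<lambda>_. node_keys_pmf m a K P))"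

text \<open>
  \<open>Digraph_Component.connected\<close> is graph connectedness; the unqualified name could also denote
  topological connectedness.
\<close>

definition prob_connected ::
    "nat \<Rightarrow> nat \<Rightarrow> (nat \<Rightarrow> real) \<Rightarrow> (nat \<Rightarrow> nat) \<Rightarrow> nat \<Rightarrow> real" where
  "prob_connected n m a K P =
    measure_pmf.prob (het_random_key_graph n m a K P)
      {G. Digraph_Component.connected (with_proj G)}"

end

theory Submission
  imports Defs "HOL-Real_Asymp.Real_Asymp"
begin

text \<open>
  Zero law: the nodes that hold exactly \<open>K\<^sub>1\<close> keys and are isolated have diverging expected number,
  and log-concavity of binomial coefficients keeps two such events nearly uncorrelated, so the
  second moment method yields an isolated node.

  One law: a disconnected graph has a cut between \<open>r\<close> and \<open>n - r\<close> nodes for some \<open>1 \<le> r \<le> n / 2\<close>.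
  Shrinking every key set on the small side to \<open>K\<^sub>1\<close> uniform keys only makes the cut more likely, so
  the expected number of such cuts is at most \<open>(n choose r) * E[avoid (X) ^ (n - r)]\<close>, where \<open>X\<close> is the
  size of the union of \<open>r\<close> uniform \<open>K\<^sub>1\<close>-subsets and \<open>avoid u\<close> the probability that a node avoids
  \<open>u\<close> given keys. If \<open>X\<close> were \<open>r K\<^sub>1\<close> this would be the sum known from Erdos-Renyi
  graphs. Since \<open>K\<^sub>1\<close> tends to infinity and \<open>P = \<Omega>(n)\<close>, unions much smaller than \<open>min (r K\<^sub>1) P\<close> are negligible even against
  \<open>n choose r\<close>; connectivity inside the small side is never used.
\<close>

subsection \<open>Binomial coefficients\<close>

text \<open>Two features rule out a single estimate of the cut terms:
  \<open>K\<^sub>m / K\<^sub>1\<close> may be unbounded, and \<beta> may grow at any speed.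
  Linearizing, so that \<open>u\<close> given keys count as \<open>u / K\<^sub>1\<close> nodes of
  group 1, is sound only while \<open>u * K\<^sub>m / P\<close> is small; beyond that, group
  \<open>m\<close> alone hits with a constant chance, because its weight is fixed. Put
  \<open>M = n * edge_rate\<close>. Losing constant fractions of the exponent \<open>r * M\<close>
  (overlapping keys, linearization, the \<open>r\<close> nodes themselves) is affordable when the
  logarithm of \<open>n choose r\<close> is at most about \<open>r * M / 2\<close>: this holds if
  \<open>M > 2 ln n\<close>, and also if \<open>r > sqrt n\<close>. In the remaining corner the
  errors must be O(1) per node of the small side, and the exponential moment of the union size
  achieves that. Values of \<open>r\<close> linear in \<open>n\<close> need
  \<open>n * K\<^sub>1 ^ 2 / P\<close> to tend to infinity, which is the assumed lower bound on
  \<open>K\<^sub>1\<close>, squared.\<close>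

lemma Suc_times_binomial_real: "real (Suc k) * real (n choose Suc k) = real (n choose k) * (real n - real k)"
proof (cases "k \<le> n")
  case True
  have "Suc k * (n choose Suc k) = (n - k) * (n choose k)"
    by (metis binomial_absorb_comp binomial_absorption diff_Suc_1)
  then have "real (Suc k * (n choose Suc k)) = real ((n - k) * (n choose k))" by simp
  then show ?thesis using True by (simp add: of_nat_diff algebra_simps)
next
  case False
  then show ?thesis by (simp add: binomial_eq_0)
qed

text \<open>The quotient of the two coefficients is a product of \<open>k\<close> factors
  \<open>(U - i) / (P - i)\<close>, each at most \<open>U / P\<close>.\<close>

lemma binomial_le_power_ratio:
  assumes "U \<le> P"
  shows "real (U choose k) \<le> (real U / real P) ^ k * real (P choose k)"
proof (cases "P = 0")
  case True
  with assms show ?thesis by (cases k) auto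
next
  case P: False
  show ?thesis
  proof (induction k)
    case (Suc k)
    show ?case
    proof (cases "k \<le> U")
      case True
      have "real (Suc k) * real (U choose Suc k) = real (U choose k) * (real U - real k)"
        by (rule Suc_times_binomial_real)
      also have "\<dots> \<le> ((real U / real P) ^ k * real (P choose k)) * (real U - real k)"
        using Suc True by (intro mult_right_mono) auto
      also have "\<dots> \<le> ((real U / real P) ^ k * real (P choose k)) * (real U / real P * (real P - real k))"
      proof (rule mult_left_mono)
        have "real U * real k \<le> real P * real k"
          using assms by (intro mult_right_mono) auto
        then show "real U - real k \<le> real U / real P * (real P - real k)"
          using P by (simp add: field_simps)
      qed simp
      also have "\<dots> = (real U / real P) ^ Suc k * (real (Suc k) * real (P choose Suc k))"
        unfolding Suc_times_binomial_real by simp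
      finally have "real (Suc k) * real (U choose Suc k)
          \<le> real (Suc k) * ((real U / real P) ^ Suc k * real (P choose Suc k))"
        by (simp only: mult.left_commute)
      then show ?thesis by (rule mult_left_le_imp_le) simp
    qed (simp add: binomial_eq_0)
  qed simp
qed

text \<open>A union bound in counting form: by Pascal's rule each forbidden key removes at most
  \<open>(P - 1) choose (k - 1)\<close> of the \<open>k\<close>-subsets, a fraction
  \<open>k / P\<close> of all of them.\<close>

lemma binomial_diff_ge:
  assumes "1 \<le> k" "k \<le> P" "u \<le> P"
  shows "real ((P - u) choose k) \<ge> (1 - real u * real k / real P) * real (P choose k)"
  using assms(3)
proof (induction u)
  case (Suc u)
  have P: "P > 0" using assms by simp
  from Suc have u: "P - u = Suc (P - Suc u)" by simp
  from assms(1) obtain k' where k: "k = Suc k'" by (cases k) auto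
  have "real ((P - u) choose k) = real ((P - Suc u) choose k) + real ((P - Suc u) choose k')"
    unfolding u k by simp
  moreover have "(P - Suc u) choose k' \<le> (P - 1) choose k'"
    by (rule binomial_right_mono) simp
  moreover have "real ((P - 1) choose k') = real k / real P * real (P choose k)"
  proof -
    have "k * (P choose k) = P * ((P - 1) choose k')"
      unfolding k by (rule binomial_absorption)
    then have "real k * real (P choose k) = real P * real ((P - 1) choose k')"
      by (metis of_nat_mult)
    then show ?thesis using P by (simp add: field_simps)
  qed
  ultimately have "real ((P - Suc u) choose k)
      \<ge> real ((P - u) choose k) - real k / real P * real (P choose k)"
    by simp
  also have "real ((P - u) choose k) - real k / real P * real (P choose k)
      \<ge> (1 - real u * real k / real P) * real (P choose k) - real k / real P * real (P choose k)"
    using Suc by simp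
  also have "(1 - real u * real k / real P) * real (P choose k) - real k / real P * real (P choose k)
      = (1 - real (Suc u) * real k / real P) * real (P choose k)"
    using P by (simp add: field_simps)
  finally show ?case .
qed simp

text \<open>Passing from \<open>k\<close> to \<open>k + 1\<close> multiplies the sides by
  \<open>(A - k) * (P - k)\<close> and \<open>(B - k)^2\<close>, where \<open>B = P - u\<close> is
  the midpoint of \<open>A = P - 2 * u\<close> and \<open>P\<close>. In terms of probabilities:
  avoiding \<open>2 * u\<close> keys is at most as likely as two independent avoidances of
  \<open>u\<close> keys.\<close>

lemma binomial_log_concave:
  assumes "2 * u \<le> P"
  shows "real ((P - 2 * u) choose k) * real (P choose k) \<le> (real ((P - u) choose k))\<^sup>2"
proof (induction k)
  case (Suc k)
  show ?case
  proof (cases "k \<le> P - 2 * u")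
    case True
    let ?A = "P - 2 * u" and ?B = "P - u"
    have "(real (Suc k) * real (?A choose Suc k)) * (real (Suc k) * real (P choose Suc k))
        = (real (?A choose k) * real (P choose k)) * ((real ?A - real k) * (real P - real k))"
      unfolding Suc_times_binomial_real by (simp only: mult_ac)
    also have "\<dots> \<le> (real (?B choose k))\<^sup>2 * (real ?B - real k)\<^sup>2"
    proof (rule mult_mono)
      have "real ?A = real P - 2 * real u" "real ?B = real P - real u"
        using assms by (auto simp: of_nat_diff)
      then show "(real ?A - real k) * (real P - real k) \<le> (real ?B - real k)\<^sup>2"
        by (simp add: power2_eq_square algebra_simps)
      show "0 \<le> (real ?A - real k) * (real P - real k)"
        using True by (intro mult_nonneg_nonneg) auto
    qed (use Suc in auto)
    also have "\<dots> = (real (Suc k) * real (?B choose Suc k))\<^sup>2"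
      unfolding Suc_times_binomial_real by (simp only: power_mult_distrib)
    finally have "(real (Suc k))\<^sup>2 * (real (?A choose Suc k) * real (P choose Suc k))
        \<le> (real (Suc k))\<^sup>2 * (real (?B choose Suc k))\<^sup>2"
      by (simp only: power2_eq_square mult_ac)
    then show ?thesis by (rule mult_left_le_imp_le) simp
  qed (simp add: binomial_eq_0)
qed simp

text \<open>Combines \<open>(n choose r) * r! <= n^r\<close> with \<open>r^r / r! <= e^r\<close>,
  the latter by keeping one term of the exponential series.\<close>

lemma binomial_le_exp:
  assumes "1 \<le> r"
  shows "real (n choose r) \<le> (exp 1 * real n / real r) ^ r"
proof -
  have "real ((n choose r) * fact r) \<le> real (n ^ r)"
    using binomial_fact_pow by (simp only: of_nat_le_iff)
  then have 1: "real (n choose r) * fact r \<le> real n ^ r" by simp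
  have "(real r) ^ r / fact r \<le> exp (real r)"
  proof -
    have "summable (\<lambda>n. real r ^ n /\<^sub>R fact n)" by (rule summable_exp_generic)
    then have "(\<Sum>n\<in>{r}. real r ^ n /\<^sub>R fact n) \<le> (\<Sum>n. real r ^ n /\<^sub>R fact n)"
      by (rule sum_le_suminf) auto
    then show ?thesis by (simp add: exp_def field_simps)
  qed
  also have "exp (real r) = (exp 1) ^ r"
    by (simp add: exp_of_nat_mult[symmetric])
  finally have 2: "real r ^ r \<le> exp 1 ^ r * fact r" by (simp add: field_simps)
  have "real (n choose r) * real r ^ r \<le> real (n choose r) * (exp 1 ^ r * fact r)"
    using 2 by (intro mult_left_mono) auto
  also have "\<dots> \<le> exp 1 ^ r * real n ^ r"
    using 1 by (simp add: mult.left_commute mult_left_mono)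
  finally show ?thesis using assms
    by (simp add: power_divide power_mult_distrib field_simps)
qed

subsection \<open>Connectedness and cuts\<close>

text \<open>Connectedness is defined as strong connectedness of the symmetric closure; since the key
  graph is its own closure, it amounts to reachability between all pairs of nodes.\<close>

lemma mk_symmetric_key_graph: "mk_symmetric (with_proj (key_graph V S)) = key_graph V S"
  by (rule pair_pre_digraph.equality) (auto simp: mk_symmetric_def key_graph_def)

text \<open>No edge leaves the set of nodes reachable from \<open>u\<close>, nor its complement;
  \<open>T\<close> is whichever of the two has at most half of the nodes.\<close>

lemma not_connected_obtains_cut:
  fixes n :: nat
  assumes "1 \<le> n" "\<not> Digraph_Component.connected (with_proj (key_graph {1..n} S))"
  obtains T where "T \<subseteq> {1..n}" "1 \<le> card T" "2 * card T \<le> n"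
    "\<And>v w. v \<in> T \<Longrightarrow> w \<in> {1..n} - T \<Longrightarrow> S v \<inter> S w = {}"
proof -
  let ?G = "with_proj (key_graph {1..n} S)"
  have pv: "pverts (key_graph {1..n} S) = {1..n}"
    by (simp add: key_graph_def)
  interpret pair_graph "key_graph {1..n} S" by (rule pair_graph_key_graph) simp
  from assms obtain u v where uv: "u \<in> {1..n}" "v \<in> {1..n}" "\<not> u \<rightarrow>\<^sup>*\<^bsub>?G\<^esub> v"
    unfolding Digraph_Component.connected_def mk_symmetric_key_graph strongly_connected_def
      with_proj_simps pv by auto
  define C where "C = {w \<in> {1..n}. u \<rightarrow>\<^sup>*\<^bsub>?G\<^esub> w}"
  have "u \<rightarrow>\<^sup>*\<^bsub>?G\<^esub> u"
    by (rule reachable_refl) (use uv pv in simp)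
  then have C: "C \<subseteq> {1..n}" "u \<in> C" "v \<notin> C"
    using uv by (auto simp: C_def)
  have cut: "S x \<inter> S y = {}" if "x \<in> C" "y \<in> {1..n} - C" for x y
  proof (rule ccontr)
    assume "S x \<inter> S y \<noteq> {}"
    with that have "(x, y) \<in> parcs (key_graph {1..n} S)" by (auto simp: key_graph_def C_def)
    moreover have "u \<rightarrow>\<^sup>*\<^bsub>?G\<^esub> x" using that by (simp add: C_def)
    ultimately have "u \<rightarrow>\<^sup>*\<^bsub>?G\<^esub> y" by (rule reachable_adj_trans[rotated])
    with that show False by (auto simp: C_def)
  qed
  have fin: "finite C" using C(1) finite_subset by blast
  have cd: "card ({1..n} - C) = n - card C" "card C \<le> n"
    using C(1) by (auto simp: card_Diff_subset fin dest: card_mono[rotated])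
  show ?thesis
  proof (cases "2 * card C \<le> n")
    case True
    show ?thesis
      by (rule that[of C]) (use C True cut fin in \<open>auto simp: Suc_le_eq card_gt_0_iff\<close>)
  next
    case False
    have "1 \<le> card ({1..n} - C)"
      using uv C by (auto simp: Suc_le_eq card_gt_0_iff)
    moreover have "S x \<inter> S y = {}" if "x \<in> {1..n} - C" "y \<in> {1..n} - ({1..n} - C)" for x y
      using cut[of y x] that by auto
    ultimately show ?thesis
      using that[of "{1..n} - C"] False cd by auto
  qed
qed

lemma isolated_not_connected:
  fixes n :: nat
  assumes "2 \<le> n" "v \<in> {1..n}" "\<And>w. w \<in> {1..n} - {v} \<Longrightarrow> S v \<inter> S w = {}"
  shows "\<not> Digraph_Component.connected (with_proj (key_graph {1..n} S))"
proof
  let ?G = "with_proj (key_graph {1..n} S)"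
  assume "Digraph_Component.connected ?G"
  moreover obtain w where w: "w \<in> {1..n}" "w \<noteq> v"
    using assms(1) that[of 1] that[of 2] by (cases "v = 1") auto
  ultimately have "v \<rightarrow>\<^sup>*\<^bsub>?G\<^esub> w"
    using assms(2) unfolding Digraph_Component.connected_def mk_symmetric_key_graph strongly_connected_def
    by (simp add: key_graph_def)
  then show False
  proof (rule pre_digraph.converse_reachable_cases)
    fix x
    assume "v \<rightarrow>\<^bsub>?G\<^esub> x"
    then have "x \<in> {1..n} - {v}" "S v \<inter> S x \<noteq> {}" by (auto simp: key_graph_def)
    then show False using assms(3) by blast
  qed (use w in simp)
qed

subsection \<open>Unions of independent random sets\<close>

text \<open>Every distribution in this development has finite support, so the tower rule and
  monotonicity hold for arbitrary real integrands.\<close>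

lemma expectation_bind_pmf_finite:
  fixes h :: "'b \<Rightarrow> real"
  assumes "finite (set_pmf p)" "\<And>x. x \<in> set_pmf p \<Longrightarrow> finite (set_pmf (f x))"
  shows "measure_pmf.expectation (bind_pmf p f) h
    = measure_pmf.expectation p (\<lambda>x. measure_pmf.expectation (f x) h)"
  using assms
  by (subst pmf_expectation_bind[of "set_pmf p"], simp_all, subst integral_measure_pmf[of "set_pmf p"]) auto

lemma expectation_mono_pmf_finite:
  fixes f g :: "'a \<Rightarrow> real"
  assumes "finite (set_pmf p)" "\<And>x. x \<in> set_pmf p \<Longrightarrow> f x \<le> g x"
  shows "measure_pmf.expectation p f \<le> measure_pmf.expectation p g"
  using assms by (intro integral_mono_AE integrable_measure_pmf_finite) (auto simp: AE_measure_pmf_iff)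

lemma finite_set_Pi_pmf:
  assumes "finite A" "\<And>x. x \<in> A \<Longrightarrow> finite (set_pmf (p x))"
  shows "finite (set_pmf (Pi_pmf A d p))"
  using assms by (simp add: set_Pi_pmf finite_PiE_dflt)

text \<open>The recursion lets moment bounds go by induction on \<open>r\<close>, averaging over the
  newest set while the earlier union is fixed; \<open>map_Union_Pi_pmf\<close> returns to
  independent nodes.\<close>

primrec union_pmf :: "'k set pmf \<Rightarrow> nat \<Rightarrow> 'k set pmf" where
  "union_pmf \<mu> 0 = return_pmf {}"
| "union_pmf \<mu> (Suc r) = bind_pmf (union_pmf \<mu> r) (\<lambda>W. map_pmf (\<lambda>S. S \<union> W) \<mu>)"

lemma finite_set_union_pmf: "finite (set_pmf \<mu>) \<Longrightarrow> finite (set_pmf (union_pmf \<mu> r))"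
  by (induction r) auto

lemma expectation_union_pmf_Suc:
  fixes h :: "'k set \<Rightarrow> real"
  assumes "finite (set_pmf \<mu>)"
  shows "measure_pmf.expectation (union_pmf \<mu> (Suc r)) h
    = measure_pmf.expectation (union_pmf \<mu> r) (\<lambda>W. measure_pmf.expectation \<mu> (\<lambda>S. h (S \<union> W)))"
  using assms by (simp add: expectation_bind_pmf_finite finite_set_union_pmf)

lemma set_union_pmf_subset:
  assumes "\<And>S. S \<in> set_pmf \<mu> \<Longrightarrow> S \<subseteq> B" "W \<in> set_pmf (union_pmf \<mu> r)"
  shows "W \<subseteq> B"
  using assms(2)
proof (induction r arbitrary: W)
  case (Suc r)
  then obtain S W' where "S \<in> set_pmf \<mu>" "W' \<in> set_pmf (union_pmf \<mu> r)" "W = S \<union> W'"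
    by auto
  then show ?case
    using assms(1)[of S] Suc.IH[of W'] by simp
qed simp

lemma card_union_pmf_le:
  assumes "\<And>S. S \<in> set_pmf \<mu> \<Longrightarrow> card S = k" "W \<in> set_pmf (union_pmf \<mu> r)"
  shows "card W \<le> r * k"
  using assms(2)
proof (induction r arbitrary: W)
  case (Suc r)
  then obtain S W' where "S \<in> set_pmf \<mu>" "W' \<in> set_pmf (union_pmf \<mu> r)" "W = S \<union> W'"
    by auto
  then show ?case
    using assms(1)[of S] Suc.IH[of W'] card_Un_le[of S W'] by simp
qed simp

lemma map_Union_Pi_pmf:
  assumes "finite T"
  shows "map_pmf (\<lambda>f. \<Union>(f ` T)) (Pi_pmf T d (\<lambda>_. \<mu>)) = union_pmf \<mu> (card T)"
  using assms
proof (induction T rule: finite_induct)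
  case (insert x T)
  have "map_pmf (\<lambda>f. \<Union>(f ` insert x T)) (Pi_pmf (insert x T) d (\<lambda>_. \<mu>))
      = bind_pmf \<mu> (\<lambda>y. bind_pmf (Pi_pmf T d (\<lambda>_. \<mu>)) (\<lambda>f. return_pmf (\<Union>(f(x := y) ` insert x T))))"
    using insert by (subst Pi_pmf_insert') (simp_all add: map_bind_pmf)
  also have "\<dots> = bind_pmf \<mu> (\<lambda>y. bind_pmf (Pi_pmf T d (\<lambda>_. \<mu>)) (\<lambda>f. return_pmf (y \<union> \<Union>(f ` T))))"
  proof -
    have "(f(x := y)) ` T = f ` T" for f :: "'a \<Rightarrow> 'b set" and y
      using insert.hyps by (intro image_cong) auto
    then show ?thesis by (simp del: fun_upd_image fun_upd_apply) simp
  qed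
  \<comment> \<open>Commuting the two draws makes the newest set the inner one, as in
    \<open>union_pmf\<close>.\<close>
  also have "\<dots> = bind_pmf (Pi_pmf T d (\<lambda>_. \<mu>)) (\<lambda>f. map_pmf (\<lambda>S. S \<union> \<Union>(f ` T)) \<mu>)"
    by (subst bind_commute_pmf) (simp add: map_pmf_def)
  also have "\<dots> = bind_pmf (map_pmf (\<lambda>f. \<Union>(f ` T)) (Pi_pmf T d (\<lambda>_. \<mu>))) (\<lambda>W. map_pmf (\<lambda>S. S \<union> W) \<mu>)"
    by (simp add: bind_map_pmf)
  finally show ?case using insert by simp
qed simp

text \<open>Conditionally on the sets inside \<open>T\<close>, the nodes outside avoid their union
  independently of one another. The extra event \<open>A\<close> may depend on \<open>T\<close>
  only: it is trivial for cuts, and prescribes sizes and disjointness for isolated nodes.\<close>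

lemma prob_Pi_pmf_cut:
  assumes V: "finite V" "T \<subseteq> V" and fin: "finite (set_pmf \<mu>)"
    and A: "\<And>f g. (\<And>x. x \<in> T \<Longrightarrow> f x = g x) \<Longrightarrow> A f = A g"
  shows "measure_pmf.prob (Pi_pmf V d (\<lambda>_. \<mu>)) {f. A f \<and> (\<forall>v\<in>T. \<forall>w\<in>V - T. f v \<inter> f w = {})}
    = measure_pmf.expectation (Pi_pmf T d (\<lambda>_. \<mu>))
        (\<lambda>f. of_bool (A f) * measure_pmf.prob \<mu> {S. S \<inter> \<Union>(f ` T) = {}} ^ card (V - T))"
proof -
  let ?E = "{f. A f \<and> (\<forall>v\<in>T. \<forall>w\<in>V - T. f v \<inter> f w = {})}"
  let ?PT = "Pi_pmf T d (\<lambda>_. \<mu>)" and ?PV = "Pi_pmf (V - T) d (\<lambda>_. \<mu>)"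
  have T: "finite T" using V finite_subset by blast
  have finT: "finite (set_pmf ?PT)" "finite (set_pmf ?PV)"
    using T V fin by (auto intro!: finite_set_Pi_pmf)
  have "Pi_pmf V d (\<lambda>_. \<mu>) = Pi_pmf (T \<union> (V - T)) d (\<lambda>_. \<mu>)"
    using V by (simp add: Un_absorb1)
  also have "\<dots> = map_pmf (\<lambda>(f,g) x. if x \<in> T then f x else g x) (pair_pmf ?PT ?PV)"
    using T V by (intro Pi_pmf_union) auto
  also have "\<dots> = bind_pmf ?PT (\<lambda>f. map_pmf (\<lambda>g x. if x \<in> T then f x else g x) ?PV)"
    by (simp add: pair_pmf_def map_bind_pmf map_pmf_def bind_assoc_pmf bind_return_pmf)
  finally have eq: "Pi_pmf V d (\<lambda>_. \<mu>) = \<dots>" .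
  have "measure_pmf.prob (Pi_pmf V d (\<lambda>_. \<mu>)) ?E = measure_pmf.expectation (Pi_pmf V d (\<lambda>_. \<mu>)) (indicator ?E)"
    by simp
  also have "\<dots> = measure_pmf.expectation ?PT
      (\<lambda>f. measure_pmf.prob (map_pmf (\<lambda>g x. if x \<in> T then f x else g x) ?PV) ?E)"
    unfolding eq using finT by (subst expectation_bind_pmf_finite) auto
  also have "\<dots> = measure_pmf.expectation ?PT
        (\<lambda>f. of_bool (A f) * measure_pmf.prob \<mu> {S. S \<inter> \<Union>(f ` T) = {}} ^ card (V - T))"
  proof (intro arg_cong[where f = "measure_pmf.expectation ?PT"] ext)
    fix f :: "'a \<Rightarrow> 'b set"
    let ?h = "\<lambda>g x. if x \<in> T then f x else g x"
    have "?h -` ?E = (if A f then Pi (V - T) (\<lambda>_. {S. S \<inter> \<Union>(f ` T) = {}}) else {})"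
    proof -
      have "A (?h g) = A f" for g by (rule A) simp
      then show ?thesis by (auto simp: Pi_def)
    qed
    then have "measure_pmf.prob (map_pmf ?h ?PV) ?E
        = of_bool (A f) * measure_pmf.prob ?PV (Pi (V - T) (\<lambda>_. {S. S \<inter> \<Union>(f ` T) = {}}))"
      by simp
    also have "\<dots> = of_bool (A f) * measure_pmf.prob \<mu> {S. S \<inter> \<Union>(f ` T) = {}} ^ card (V - T)"
      using V by (subst measure_Pi_pmf_Pi) auto
    finally show "measure_pmf.prob (map_pmf ?h ?PV) ?E = \<dots>" .
  qed
  finally show ?thesis .
qed

subsection \<open>Uniform key sets\<close>

lemma key_sets_finite_elem: "S \<in> key_sets P k \<Longrightarrow> finite S"
  by (auto simp: key_sets_def intro: finite_subset)

lemma set_pmf_of_key_sets: "k \<le> P \<Longrightarrow> set_pmf (pmf_of_set (key_sets P k)) = key_sets P k"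
  by (intro set_pmf_of_set key_sets_nonempty finite_key_sets)

lemma expectation_key_sets:
  fixes h :: "nat set \<Rightarrow> real"
  assumes "k \<le> P"
  shows "measure_pmf.expectation (pmf_of_set (key_sets P k)) h = sum h (key_sets P k) / real (P choose k)"
  using integral_pmf_of_set[OF key_sets_nonempty[OF assms] finite_key_sets] by (simp add: card_key_sets)

lemma card_key_sets_disjoint:
  assumes "W \<subseteq> {..<P}"
  shows "card {S \<in> key_sets P k. S \<inter> W = {}} = (P - card W) choose k"
proof -
  have "{S \<in> key_sets P k. S \<inter> W = {}} = {S. S \<subseteq> {..<P} - W \<and> card S = k}"
    by (auto simp: key_sets_def)
  then show ?thesis
    using assms finite_subset[OF assms] by (simp add: n_subsets card_Diff_subset)
qed

lemma card_key_sets_within: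
  assumes "B \<in> key_sets P u"
  shows "card {S \<in> key_sets P k. S \<subseteq> B} = u choose k"
proof -
  have "{S \<in> key_sets P k. S \<subseteq> B} = {S. S \<subseteq> B \<and> card S = k}"
    using assms by (auto simp: key_sets_def)
  then show ?thesis
    using assms key_sets_finite_elem[OF assms] by (simp add: n_subsets) (simp add: key_sets_def)
qed

lemma card_key_sets_above:
  assumes "I \<in> key_sets P i" "i \<le> k"
  shows "card {S \<in> key_sets P k. I \<subseteq> S} = (P - i) choose (k - i)"
proof -
  have fin: "finite I" and I: "I \<subseteq> {..<P}" "card I = i"
    using assms key_sets_finite_elem[OF assms(1)] by (simp_all add: key_sets_def)
  have "bij_betw (\<lambda>S. S \<union> I) {S. S \<subseteq> {..<P} - I \<and> card S = k - i} {S \<in> key_sets P k. I \<subseteq> S}"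
  proof (rule bij_betw_byWitness[where f' = "\<lambda>S. S - I"])
    show "(\<lambda>S. S \<union> I) ` {S. S \<subseteq> {..<P} - I \<and> card S = k - i} \<subseteq> {S \<in> key_sets P k. I \<subseteq> S}"
    proof safe
      fix S assume S: "S \<subseteq> {..<P} - I" "card S = k - i"
      from S(1) have "finite S" by (rule finite_subset) simp
      then have "card (S \<union> I) = card S + card I"
        using fin S by (intro card_Un_disjoint) auto
      with S I assms(2) show "S \<union> I \<in> key_sets P k"
        by (auto simp: key_sets_def)
    qed
    show "(\<lambda>S. S - I) ` {S \<in> key_sets P k. I \<subseteq> S} \<subseteq> {S. S \<subseteq> {..<P} - I \<and> card S = k - i}"
      using I fin by (auto simp: key_sets_def card_Diff_subset)
  qed auto
  then have "card {S \<in> key_sets P k. I \<subseteq> S} = card {S. S \<subseteq> {..<P} - I \<and> card S = k - i}"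
    by (rule bij_betw_same_card[symmetric])
  then show ?thesis
    using I fin by (simp add: n_subsets card_Diff_subset)
qed

text \<open>Double counting of the pairs \<open>T \<subseteq> S\<close> with
  \<open>card T = k\<close> and \<open>card S = l\<close>: a uniform \<open>k\<close>-subset of a
  uniform \<open>l\<close>-set is a uniform \<open>k\<close>-set, and \<open>h\<close> does not
  decrease when \<open>S\<close> shrinks to it.\<close>

lemma expectation_key_sets_antimono:
  fixes h :: "nat set \<Rightarrow> real"
  assumes kl: "k \<le> l" "l \<le> P"
    and h: "\<And>S T. S \<subseteq> T \<Longrightarrow> T \<subseteq> {..<P} \<Longrightarrow> h T \<le> h S"
  shows "measure_pmf.expectation (pmf_of_set (key_sets P l)) h
      \<le> measure_pmf.expectation (pmf_of_set (key_sets P k)) h"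
proof -
  have "sum h (key_sets P l) * real (l choose k) = (\<Sum>S\<in>key_sets P l. \<Sum>T | T \<in> key_sets P k \<and> T \<subseteq> S. h S)"
    by (subst sum_distrib_right) (intro sum.cong refl, simp add: card_key_sets_within)
  also have "\<dots> \<le> (\<Sum>S\<in>key_sets P l. \<Sum>T | T \<in> key_sets P k \<and> T \<subseteq> S. h T)"
    by (intro sum_mono h) (auto simp: key_sets_def)
  also have "\<dots> = (\<Sum>T\<in>key_sets P k. \<Sum>S | S \<in> key_sets P l \<and> T \<subseteq> S. h T)"
    by (rule sum.swap_restrict) (simp_all add: finite_key_sets)
  also have "\<dots> = sum h (key_sets P k) * real ((P - k) choose (l - k))"
    using kl by (subst sum_distrib_right) (intro sum.cong refl, simp add: card_key_sets_above)
  finally have *: "sum h (key_sets P l) * real (l choose k) \<le> sum h (key_sets P k) * real ((P - k) choose (l - k))" .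
  have cm: "real (P choose l) * real (l choose k) = real (P choose k) * real ((P - k) choose (l - k))"
    using kl by (metis choose_mult of_nat_mult)
  have pos: "real (P choose l) > 0" "real (l choose k) > 0" "real (P choose k) > 0"
    using kl by (auto simp: zero_less_binomial_iff)
  have "sum h (key_sets P l) / real (P choose l)
      = sum h (key_sets P l) * real (l choose k) / (real (P choose l) * real (l choose k))"
    using pos by simp
  also have "\<dots> \<le> sum h (key_sets P k) * real ((P - k) choose (l - k)) / (real (P choose l) * real (l choose k))"
    using * pos by (intro divide_right_mono) auto
  also have "\<dots> = sum h (key_sets P k) / real (P choose k)"
    using pos unfolding cm by (cases "(P - k) choose (l - k) = 0") (use cm in auto)
  finally show ?thesis using kl by (simp add: expectation_key_sets)
qed

text \<open>The exact value is \<open>(k choose i) / (P choose i)\<close> with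
  \<open>i = card I\<close>. Including each key independently with probability \<open>k / P\<close>
  would give the right-hand side.\<close>

lemma prob_key_sets_superset_le:
  assumes "I \<subseteq> {..<P}" "k \<le> P"
  shows "measure_pmf.prob (pmf_of_set (key_sets P k)) {S. I \<subseteq> S} \<le> (real k / real P) ^ card I"
proof -
  define i where "i = card I"
  have I: "I \<in> key_sets P i" using assms by (simp add: key_sets_def i_def)
  have eq: "measure_pmf.prob (pmf_of_set (key_sets P k)) {S. I \<subseteq> S}
      = real (card {S \<in> key_sets P k. I \<subseteq> S}) / real (P choose k)"
    using assms by (subst measure_pmf_of_set)
      (simp_all add: key_sets_nonempty finite_key_sets card_key_sets Int_def)
  show ?thesis
  proof (cases "i \<le> k")
    case True
    have pos: "real (P choose k) > 0" "real (P choose i) > 0"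
      using assms True by (auto simp: zero_less_binomial_iff)
    have "real (P choose i) * real ((P - i) choose (k - i)) = real (P choose k) * real (k choose i)"
      using True assms by (metis choose_mult of_nat_mult)
    also have "\<dots> \<le> real (P choose k) * ((real k / real P) ^ i * real (P choose i))"
      using assms by (intro mult_left_mono binomial_le_power_ratio) auto
    finally have "real (P choose i) * real ((P - i) choose (k - i))
        \<le> real (P choose i) * (real (P choose k) * (real k / real P) ^ i)"
      by (simp add: mult_ac)
    then have "real ((P - i) choose (k - i)) \<le> real (P choose k) * (real k / real P) ^ i"
      using pos by (simp only: mult_le_cancel_left_pos)
    then show ?thesis
      unfolding eq card_key_sets_above[OF I True] using pos by (simp add: field_simps i_def)
  next
    case False
    have "card S \<noteq> k" if "I \<subseteq> S" "S \<subseteq> {..<P}" for S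
      using card_mono[OF finite_subset[OF that(2)] that(1)] False by (auto simp: i_def)
    then have empty: "{S \<in> key_sets P k. I \<subseteq> S} = {}"
      by (auto simp: key_sets_def)
    show ?thesis unfolding eq empty by simp
  qed
qed

lemma sum_power_card_Pow:
  fixes x :: real
  assumes "finite A"
  shows "(\<Sum>I\<in>Pow A. x ^ card I) = (1 + x) ^ card A"
  using assms
proof (induction A rule: finite_induct)
  case (insert b A)
  have "(\<Sum>I\<in>Pow (insert b A). x ^ card I) = (\<Sum>I\<in>Pow A. x ^ card I) + (\<Sum>I\<in>insert b ` Pow A. x ^ card I)"
    unfolding Pow_insert using insert by (intro sum.union_disjoint) auto
  also have "(\<Sum>I\<in>insert b ` Pow A. x ^ card I) = (\<Sum>I\<in>Pow A. x * x ^ card I)"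
  proof (subst sum.reindex)
    show "inj_on (insert b) (Pow A)"
      using insert by (auto simp: inj_on_def)
    have "card (insert b I) = Suc (card I)" if "I \<subseteq> A" for I
      using that insert finite_subset by (subst card_insert_disjoint) auto
    then show "sum ((\<lambda>I. x ^ card I) \<circ> insert b) (Pow A) = (\<Sum>I\<in>Pow A. x * x ^ card I)"
      by (intro sum.cong) auto
  qed
  finally show ?case
    using insert by (simp add: sum_distrib_left[symmetric] algebra_simps)
qed simp

text \<open>The expansion \<open>t ^ |A| = (\<Sum>I \<subseteq> A. (t - 1) ^ |I|)\<close> reduces the generating function of the
  overlap to the containment probabilities above.\<close>

lemma expectation_power_overlap_le:
  assumes "W \<subseteq> {..<P}" "k \<le> P" "1 \<le> t"
  shows "measure_pmf.expectation (pmf_of_set (key_sets P k)) (\<lambda>S. t ^ card (S \<inter> W))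
    \<le> (1 + (t - 1) * (real k / real P)) ^ card W"
proof -
  let ?\<kappa> = "pmf_of_set (key_sets P k)"
  have W: "finite W" using assms finite_subset by blast
  have fin: "finite (set_pmf ?\<kappa>)" using assms by (simp add: set_pmf_of_key_sets finite_key_sets)
  have "t ^ card (S \<inter> W) = (\<Sum>I\<in>Pow W. (t - 1) ^ card I * indicator {S. I \<subseteq> S} S)" for S
  proof -
    have "t ^ card (S \<inter> W) = (1 + (t - 1)) ^ card (S \<inter> W)" by simp
    also have "\<dots> = (\<Sum>I\<in>Pow (S \<inter> W). (t - 1) ^ card I)"
      using W by (intro sum_power_card_Pow[symmetric]) auto
    also have "\<dots> = (\<Sum>I\<in>Pow W. (t - 1) ^ card I * indicator {S. I \<subseteq> S} S)"
      using W by (intro sum.mono_neutral_cong_left) (auto simp: indicator_def)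
    finally show ?thesis .
  qed
  then have "measure_pmf.expectation ?\<kappa> (\<lambda>S. t ^ card (S \<inter> W))
      = measure_pmf.expectation ?\<kappa> (\<lambda>S. \<Sum>I\<in>Pow W. (t - 1) ^ card I * indicator {S. I \<subseteq> S} S)"
    by simp
  also have "\<dots> = (\<Sum>I\<in>Pow W. (t - 1) ^ card I * measure_pmf.prob ?\<kappa> {S. I \<subseteq> S})"
    using fin by (subst Bochner_Integration.integral_sum) (auto intro!: integrable_measure_pmf_finite)
  also have "\<dots> \<le> (\<Sum>I\<in>Pow W. (t - 1) ^ card I * (real k / real P) ^ card I)"
    using assms by (intro sum_mono mult_left_mono prob_key_sets_superset_le) auto
  also have "\<dots> = (1 + (t - 1) * (real k / real P)) ^ card W"
    using W by (simp add: power_mult_distrib[symmetric] sum_power_card_Pow)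
  finally show ?thesis .
qed

text \<open>A union of at most \<open>U\<close> keys lies in some \<open>B\<close> with exactly
  \<open>U\<close> keys, and all \<open>r\<close> independent sets fall into a fixed
  \<open>B\<close> with probability at most \<open>(U / P) ^ (r * k)\<close>; then a union bound
  over \<open>B\<close>.\<close>

lemma prob_union_key_sets_small_le:
  assumes "k \<le> P" "U \<le> P"
  shows "measure_pmf.prob (union_pmf (pmf_of_set (key_sets P k)) r) {W. card W \<le> U}
    \<le> real (P choose U) * (real U / real P) ^ (r * k)"
proof -
  let ?\<kappa> = "pmf_of_set (key_sets P k)"
  have set: "set_pmf ?\<kappa> = key_sets P k" using assms by (simp add: set_pmf_of_key_sets)
  have fin: "finite (set_pmf ?\<kappa>)" by (simp add: set finite_key_sets)
  have within: "measure_pmf.prob (union_pmf ?\<kappa> r) {W. W \<subseteq> B} \<le> (real U / real P) ^ (r * k)"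
    if B: "B \<in> key_sets P U" for B
  proof -
    have one: "measure_pmf.prob ?\<kappa> {S. S \<subseteq> B} \<le> (real U / real P) ^ k"
    proof -
      have "measure_pmf.prob ?\<kappa> {S. S \<subseteq> B} = real (card {S \<in> key_sets P k. S \<subseteq> B}) / real (P choose k)"
        using assms by (subst measure_pmf_of_set)
          (simp_all add: key_sets_nonempty finite_key_sets card_key_sets Int_def)
      also have "\<dots> = real (U choose k) / real (P choose k)"
        by (simp add: card_key_sets_within[OF B])
      also have "\<dots> \<le> (real U / real P) ^ k"
        using binomial_le_power_ratio[OF assms(2), of k] assms by (simp add: divide_le_eq zero_less_binomial_iff)
      finally show ?thesis .
    qed
    show ?thesis
    proof (induction r)
      case (Suc r)
      have "measure_pmf.prob (union_pmf ?\<kappa> (Suc r)) {W. W \<subseteq> B}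
          = measure_pmf.expectation (union_pmf ?\<kappa> (Suc r)) (indicator {W. W \<subseteq> B})"
        by simp
      also have "\<dots> = measure_pmf.expectation (union_pmf ?\<kappa> r)
          (\<lambda>W. measure_pmf.expectation ?\<kappa> (\<lambda>S. indicator {W. W \<subseteq> B} W * indicator {S. S \<subseteq> B} S))"
        unfolding expectation_union_pmf_Suc[OF fin]
        by (intro Bochner_Integration.integral_cong) (auto simp: indicator_def)
      also have "\<dots> = measure_pmf.prob (union_pmf ?\<kappa> r) {W. W \<subseteq> B} * measure_pmf.prob ?\<kappa> {S. S \<subseteq> B}"
        by simp
      also have "\<dots> \<le> (real U / real P) ^ (r * k) * (real U / real P) ^ k"
        using Suc one by (intro mult_mono) auto
      finally show ?case by (simp add: power_add mult.commute)
    qed simp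
  qed
  have "{W. card W \<le> U} \<inter> set_pmf (union_pmf ?\<kappa> r) \<subseteq> (\<Union>B\<in>key_sets P U. {W. W \<subseteq> B})"
  proof safe
    fix W assume W: "card W \<le> U" "W \<in> set_pmf (union_pmf ?\<kappa> r)"
    have sub: "W \<subseteq> {..<P}"
      by (rule set_union_pmf_subset[OF _ W(2)]) (use set in \<open>auto simp: key_sets_def\<close>)
    have "\<exists>B. W \<subseteq> B \<and> B \<subseteq> {..<P} \<and> card B = U"
      by (rule exists_subset_between) (use W sub assms(2) in auto)
    then show "W \<in> (\<Union>B\<in>key_sets P U. {W. W \<subseteq> B})"
      by (auto simp: key_sets_def)
  qed
  then have "measure_pmf.prob (union_pmf ?\<kappa> r) {W. card W \<le> U}
      \<le> measure_pmf.prob (union_pmf ?\<kappa> r) (\<Union>B\<in>key_sets P U. {W. W \<subseteq> B})"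
    by (subst measure_Int_set_pmf[symmetric]) (auto intro!: measure_pmf.finite_measure_mono)
  also have "\<dots> \<le> (\<Sum>B\<in>key_sets P U. measure_pmf.prob (union_pmf ?\<kappa> r) {W. W \<subseteq> B})"
    by (intro measure_pmf.finite_measure_subadditive_finite finite_key_sets) auto
  also have "\<dots> \<le> (\<Sum>B\<in>key_sets P U. (real U / real P) ^ (r * k))"
    by (intro sum_mono within)
  finally show ?thesis by (simp add: card_key_sets)
qed

text \<open>Without overlaps the value would be \<open>exp (- \<theta> * r * k)\<close>. A new set
  \<open>S\<close> adds \<open>k - card (S \<inter> W)\<close> keys, and the generating function of
  the overlap at \<open>exp \<theta>\<close> supplies the error term. The bound \<open>R\<close> on
  \<open>r\<close> stays fixed during the induction, so \<open>card W <= R * k\<close> makes this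
  error the same in every step.\<close>

lemma expectation_exp_union_key_sets_le:
  assumes k: "k \<le> P" and "r \<le> R" "0 \<le> \<theta>"
  shows "measure_pmf.expectation (union_pmf (pmf_of_set (key_sets P k)) r) (\<lambda>W. exp (- \<theta> * real (card W)))
    \<le> exp (real r * (- \<theta> * real k + real R * exp \<theta> * (real k)\<^sup>2 / real P))"
  using assms(2)
proof (induction r)
  case (Suc r)
  let ?\<kappa> = "pmf_of_set (key_sets P k)"
  let ?q = "- \<theta> * real k + real R * exp \<theta> * (real k)\<^sup>2 / real P"
  have set: "set_pmf ?\<kappa> = key_sets P k" using k by (simp add: set_pmf_of_key_sets)
  have fin: "finite (set_pmf ?\<kappa>)" by (simp add: set finite_key_sets)
  have step: "measure_pmf.expectation ?\<kappa> (\<lambda>S. exp (- \<theta> * real (card (S \<union> W))))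
      \<le> exp (- \<theta> * real (card W)) * exp ?q" if W: "W \<in> set_pmf (union_pmf ?\<kappa> r)" for W
  proof -
    have sub: "W \<subseteq> {..<P}"
      by (rule set_union_pmf_subset[OF _ W]) (use set in \<open>auto simp: key_sets_def\<close>)
    have finW: "finite W" using sub finite_subset by blast
    have "card W \<le> r * k"
      by (rule card_union_pmf_le[OF _ W]) (use set in \<open>auto simp: key_sets_def\<close>)
    also have "\<dots> \<le> R * k" using Suc.prems by (intro mult_right_mono) auto
    finally have cW: "real (card W) \<le> real R * real k" by (metis of_nat_le_iff of_nat_mult)
    have "measure_pmf.expectation ?\<kappa> (\<lambda>S. exp (- \<theta> * real (card (S \<union> W))))
        = measure_pmf.expectation ?\<kappa> (\<lambda>S. exp (- \<theta> * real (card W)) * exp (- \<theta> * real k) * exp \<theta> ^ card (S \<inter> W))"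
    proof (rule integral_cong_AE)
      have "exp (- \<theta> * real (card (S \<union> W)))
          = exp (- \<theta> * real (card W)) * exp (- \<theta> * real k) * exp \<theta> ^ card (S \<inter> W)"
        if "S \<in> key_sets P k" for S
      proof -
        have "card S + card W = card (S \<union> W) + card (S \<inter> W)"
          using that finW key_sets_finite_elem by (intro card_Un_Int) auto
        with that have "real (card (S \<union> W)) = real k + real (card W) - real (card (S \<inter> W))"
          by (simp add: key_sets_def)
        then show ?thesis
          by (simp only: exp_of_nat_mult[symmetric] exp_add[symmetric]) (simp add: algebra_simps)
      qed
      then show "AE S in ?\<kappa>. exp (- \<theta> * real (card (S \<union> W)))
          = exp (- \<theta> * real (card W)) * exp (- \<theta> * real k) * exp \<theta> ^ card (S \<inter> W)"
        by (simp add: AE_measure_pmf_iff set)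
    qed auto
    also have "\<dots> = exp (- \<theta> * real (card W)) * exp (- \<theta> * real k)
        * measure_pmf.expectation ?\<kappa> (\<lambda>S. exp \<theta> ^ card (S \<inter> W))"
      by simp
    also have "measure_pmf.expectation ?\<kappa> (\<lambda>S. exp \<theta> ^ card (S \<inter> W))
        \<le> (1 + (exp \<theta> - 1) * (real k / real P)) ^ card W"
      using assms sub by (intro expectation_power_overlap_le) auto
    also have "\<dots> \<le> exp (real R * exp \<theta> * (real k)\<^sup>2 / real P)"
    proof -
      have "1 + (exp \<theta> - 1) * (real k / real P) \<le> 1 + exp \<theta> * (real k / real P)"
        by (intro add_left_mono mult_right_mono) auto
      also have "\<dots> \<le> exp (exp \<theta> * (real k / real P))" by (rule exp_ge_add_one_self)
      finally have "(1 + (exp \<theta> - 1) * (real k / real P)) ^ card W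
          \<le> exp (exp \<theta> * (real k / real P)) ^ card W"
        using assms by (intro power_mono) auto
      also have "\<dots> = exp (real (card W) * (exp \<theta> * (real k / real P)))"
        by (simp only: exp_of_nat_mult)
      also have "\<dots> \<le> exp ((real R * real k) * (exp \<theta> * (real k / real P)))"
        using cW by (intro iffD2[OF exp_le_cancel_iff] mult_right_mono) auto
      finally show ?thesis by (simp add: power2_eq_square mult_ac)
    qed
    finally show ?thesis unfolding exp_add by (simp add: mult_ac)
  qed
  have "measure_pmf.expectation (union_pmf ?\<kappa> (Suc r)) (\<lambda>W. exp (- \<theta> * real (card W)))
      \<le> measure_pmf.expectation (union_pmf ?\<kappa> r) (\<lambda>W. exp (- \<theta> * real (card W)) * exp ?q)"
    unfolding expectation_union_pmf_Suc[OF fin]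
    using step by (intro expectation_mono_pmf_finite finite_set_union_pmf fin)
  also have "\<dots> = measure_pmf.expectation (union_pmf ?\<kappa> r) (\<lambda>W. exp (- \<theta> * real (card W))) * exp ?q"
    by simp
  also have "\<dots> \<le> exp (real r * ?q) * exp ?q"
    using Suc by (intro mult_right_mono) auto
  also have "\<dots> = exp (real (Suc r) * ?q)"
    by (simp only: exp_add[symmetric] of_nat_Suc distrib_right mult_1_left add.commute)
  finally show ?case .
qed simp

subsection \<open>Second moments\<close>

text \<open>Chebyshev's argument: where no event occurs, the count \<open>N\<close> is 0 and
  \<open>(N / \<mu> - 1)^2\<close> equals 1, so the probability is at most the expectation of this
  square.\<close>

lemma prob_none_le_second_moment:
  fixes A :: "'i \<Rightarrow> 'a set"
  assumes fin: "finite (set_pmf p)" and I: "finite I" "I \<noteq> {}" and q: "0 < q" "0 \<le> Q"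
    and single: "\<And>i. i \<in> I \<Longrightarrow> measure_pmf.prob p (A i) = q"
    and pair: "\<And>i j. i \<in> I \<Longrightarrow> j \<in> I \<Longrightarrow> i \<noteq> j \<Longrightarrow> measure_pmf.prob p (A i \<inter> A j) \<le> Q"
  shows "measure_pmf.prob p (- (\<Union>i\<in>I. A i)) \<le> 1 / (real (card I) * q) + Q / q\<^sup>2 - 1"
proof -
  define N :: "'a \<Rightarrow> real" where "N = (\<lambda>x. \<Sum>i\<in>I. indicator (A i) x)"
  define n where "n = real (card I)"
  define \<mu> where "\<mu> = n * q"
  have n: "n > 0" using I by (simp add: n_def card_gt_0_iff)
  then have \<mu>: "\<mu> > 0" using q by (simp add: \<mu>_def)
  have integ: "integrable (measure_pmf p) f" for f :: "'a \<Rightarrow> real"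
    using fin by (rule integrable_measure_pmf_finite)
  have EN: "measure_pmf.expectation p N = \<mu>"
    unfolding N_def by (simp add: Bochner_Integration.integral_sum integ single \<mu>_def n_def)
  have "measure_pmf.expectation p (\<lambda>x. (N x)\<^sup>2)
      = measure_pmf.expectation p (\<lambda>x. \<Sum>i\<in>I. \<Sum>j\<in>I. indicator (A i \<inter> A j) x)"
    by (simp add: N_def power2_eq_square sum_product indicator_inter_arith)
  also have "\<dots> = (\<Sum>i\<in>I. \<Sum>j\<in>I. measure_pmf.prob p (A i \<inter> A j))"
    by (simp add: Bochner_Integration.integral_sum integ)
  \<comment> \<open>Adding \<open>Q\<close> on the diagonal as well is allowed by
    \<open>0 <= Q\<close> and keeps the double sum in closed form.\<close>
  also have "\<dots> \<le> (\<Sum>i\<in>I. \<Sum>j\<in>I. (if i = j then q else 0) + Q)"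
    using single pair q by (intro sum_mono) auto
  also have "\<dots> = n * q + n\<^sup>2 * Q"
    using I by (simp add: sum.distrib n_def power2_eq_square algebra_simps)
  finally have EN2: "measure_pmf.expectation p (\<lambda>x. (N x)\<^sup>2) \<le> n * q + n\<^sup>2 * Q" .
  have "measure_pmf.prob p (- (\<Union>i\<in>I. A i)) = measure_pmf.expectation p (indicator (- (\<Union>i\<in>I. A i)))"
    by simp
  also have "\<dots> \<le> measure_pmf.expectation p (\<lambda>x. (N x)\<^sup>2 / \<mu>\<^sup>2 - 2 / \<mu> * N x + 1)"
  proof (rule expectation_mono_pmf_finite[OF fin])
    fix x
    have "(N x)\<^sup>2 / \<mu>\<^sup>2 - 2 / \<mu> * N x + 1 = (N x / \<mu> - 1)\<^sup>2"
      using \<mu> by (simp add: power2_eq_square field_simps)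
    moreover have "N x = 0" if "x \<notin> (\<Union>i\<in>I. A i)"
      using that unfolding N_def by (intro sum.neutral) auto
    ultimately show "indicator (- (\<Union>i\<in>I. A i)) x \<le> (N x)\<^sup>2 / \<mu>\<^sup>2 - 2 / \<mu> * N x + 1"
      by (auto simp: indicator_def)
  qed
  also have "\<dots> = measure_pmf.expectation p (\<lambda>x. (N x)\<^sup>2) / \<mu>\<^sup>2 - 2 / \<mu> * measure_pmf.expectation p N + 1"
    by (simp add: integ)
  also have "\<dots> = measure_pmf.expectation p (\<lambda>x. (N x)\<^sup>2) / \<mu>\<^sup>2 - 1"
    unfolding EN using \<mu> by simp
  also have "\<dots> \<le> (n * q + n\<^sup>2 * Q) / \<mu>\<^sup>2 - 1"
    using EN2 by (intro diff_right_mono divide_right_mono) auto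
  also have "(n * q + n\<^sup>2 * Q) / \<mu>\<^sup>2 = 1 / (n * q) + Q / q\<^sup>2"
    using n q by (simp add: \<mu>_def power2_eq_square field_simps)
  finally show ?thesis by (simp add: n_def)
qed

subsection \<open>The key graph model\<close>

text \<open>The model for one fixed number of nodes. All estimates are non-asymptotic, so that
  limits enter only in the final theorem.\<close>

locale het_keys =
  fixes m :: nat and a :: "nat \<Rightarrow> real" and K :: "nat \<Rightarrow> nat" and P :: nat
  assumes m: "1 \<le> m"
    and a_pos: "\<And>i. i \<in> {1..m} \<Longrightarrow> 0 < a i"
    and a_sum: "(\<Sum>i = 1..m. a i) = 1"
    and K_bounds: "\<And>i. i \<in> {1..m} \<Longrightarrow> 1 \<le> K i \<and> K i \<le> P"
    and K_mono: "\<And>i j. 1 \<le> i \<Longrightarrow> i \<le> j \<Longrightarrow> j \<le> m \<Longrightarrow> K i \<le> K j"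
begin

declare One_nat_def [simp del]

abbreviation \<nu> :: "nat set pmf" where "\<nu> \<equiv> node_keys_pmf m a K P"

abbreviation \<kappa> :: "nat set pmf" where "\<kappa> \<equiv> pmf_of_set (key_sets P (K 1))"

text \<open>Truncated subtraction gives 0 for \<open>u >= P\<close>, because every
  \<open>K j\<close> is at least 1; monotonicity thus needs no bound on \<open>u\<close>.\<close>

definition avoid :: "nat \<Rightarrow> real" where
  "avoid u = (\<Sum>j = 1..m. a j * (real ((P - u) choose K j) / real (P choose K j)))"

lemma K1: "1 \<le> K 1" "K 1 \<le> P"
  using K_bounds[of 1] m by auto

lemma P_pos: "0 < P"
  using K1 by simp

lemma choose_pos: "j \<in> {1..m} \<Longrightarrow> 0 < real (P choose K j)"
  using K_bounds[of j] by (simp add: zero_less_binomial_iff)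

lemma set_pmf_group: "set_pmf (group_pmf m a) = {1..m}"
  by (simp only: set_pmf_eq pmf_group_pmf[OF a_pos a_sum]) (use a_pos in force)

lemma set_pmf_node: "set_pmf \<nu> = (\<Union>j\<in>{1..m}. key_sets P (K j))"
  unfolding node_keys_pmf_def set_bind_pmf set_pmf_group
  by (intro SUP_cong refl set_pmf_of_key_sets) (use K_bounds in auto)

lemma finite_set_node: "finite (set_pmf \<nu>)"
  by (auto simp: set_pmf_node finite_key_sets)

lemma set_node_subset: "S \<in> set_pmf \<nu> \<Longrightarrow> S \<subseteq> {..<P}"
  by (auto simp: set_pmf_node key_sets_def)

lemma set_least: "set_pmf \<kappa> = key_sets P (K 1)"
  using K1 by (intro set_pmf_of_key_sets) auto

lemma finite_set_least: "finite (set_pmf \<kappa>)"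
  by (simp add: set_least finite_key_sets)

lemma set_least_subset: "S \<in> set_pmf \<kappa> \<Longrightarrow> S \<subseteq> {..<P}"
  unfolding set_least by (simp add: key_sets_def)

lemma expectation_node:
  fixes h :: "nat set \<Rightarrow> real"
  shows "measure_pmf.expectation \<nu> h
    = (\<Sum>j = 1..m. a j * measure_pmf.expectation (pmf_of_set (key_sets P (K j))) h)"
proof -
  have "measure_pmf.expectation \<nu> h
      = (\<Sum>j\<in>{1..m}. pmf (group_pmf m a) j *\<^sub>R measure_pmf.expectation (pmf_of_set (key_sets P (K j))) h)"
    unfolding node_keys_pmf_def
    by (rule pmf_expectation_bind) (use K_bounds in \<open>auto simp: set_pmf_group set_pmf_of_key_sets finite_key_sets\<close>)
  also have "\<dots> = (\<Sum>j = 1..m. a j * measure_pmf.expectation (pmf_of_set (key_sets P (K j))) h)"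
    using pmf_group_pmf[OF a_pos a_sum] by (intro sum.cong) auto
  finally show ?thesis .
qed

lemma prob_node_avoid:
  assumes "W \<subseteq> {..<P}"
  shows "measure_pmf.prob \<nu> {S. S \<inter> W = {}} = avoid (card W)"
proof -
  have "measure_pmf.prob \<nu> {S. S \<inter> W = {}} = measure_pmf.expectation \<nu> (indicator {S. S \<inter> W = {}})"
    by simp
  also have "\<dots> = (\<Sum>j = 1..m. a j * measure_pmf.prob (pmf_of_set (key_sets P (K j))) {S. S \<inter> W = {}})"
    unfolding expectation_node by simp
  also have "\<dots> = avoid (card W)"
    unfolding avoid_def
  proof (intro sum.cong refl arg_cong2[where f = "(*)"])
    fix j assume "j \<in> {1..m}"
    then show "measure_pmf.prob (pmf_of_set (key_sets P (K j))) {S. S \<inter> W = {}}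
        = real ((P - card W) choose K j) / real (P choose K j)"
      using K_bounds[of j] by (subst measure_pmf_of_set)
        (simp_all add: key_sets_nonempty finite_key_sets card_key_sets Int_def
           flip: card_key_sets_disjoint[OF assms])
  qed
  finally show ?thesis .
qed

lemma avoid_nonneg: "0 \<le> avoid u"
  unfolding avoid_def using a_pos by (intro sum_nonneg mult_nonneg_nonneg) (auto intro: less_imp_le)

lemma avoid_antimono: "u \<le> v \<Longrightarrow> avoid v \<le> avoid u"
  unfolding avoid_def using a_pos
  by (intro sum_mono mult_left_mono divide_right_mono) (auto intro: binomial_right_mono simp: less_imp_le)

lemma avoid_le_1: "avoid u \<le> 1"
proof -
  have "avoid 0 = (\<Sum>j = 1..m. a j)"
    unfolding avoid_def
  proof (rule sum.cong)
    fix j assume "j \<in> {1..m}"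
    then show "a j * (real ((P - 0) choose K j) / real (P choose K j)) = a j"
      using choose_pos[of j] by simp
  qed simp
  then show ?thesis using avoid_antimono[of 0 u] a_sum by simp
qed

section \<open>Domination of the node distribution by key sets of the least size\<close>

lemma expectation_node_le_least:
  assumes "\<And>S T. S \<subseteq> T \<Longrightarrow> T \<subseteq> {..<P} \<Longrightarrow> h T \<le> (h S :: real)"
  shows "measure_pmf.expectation \<nu> h \<le> measure_pmf.expectation \<kappa> h"
proof -
  have "measure_pmf.expectation \<nu> h \<le> (\<Sum>j = 1..m. a j * measure_pmf.expectation \<kappa> h)"
    unfolding expectation_node
  proof (intro sum_mono mult_left_mono)
    fix j assume j: "j \<in> {1..m}"
    show "measure_pmf.expectation (pmf_of_set (key_sets P (K j))) h \<le> measure_pmf.expectation \<kappa> h"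
      by (rule expectation_key_sets_antimono) (use j K_mono[of 1 j] K_bounds[of j] assms in auto)
    show "0 \<le> a j" using a_pos j by (simp add: less_imp_le)
  qed
  then show ?thesis by (simp add: sum_distrib_right[symmetric] a_sum)
qed

text \<open>The sets are exchanged one at a time. After the newest is exchanged, averaging over it
  leaves another decreasing function of the earlier union, to which the induction hypothesis
  applies; hence \<open>h\<close> is arbitrary in the induction.\<close>

lemma expectation_union_node_le_least:
  assumes "\<And>S T. S \<subseteq> T \<Longrightarrow> T \<subseteq> {..<P} \<Longrightarrow> h T \<le> (h S :: real)"
  shows "measure_pmf.expectation (union_pmf \<nu> r) h \<le> measure_pmf.expectation (union_pmf \<kappa> r) h"
  using assms
proof (induction r arbitrary: h)
  case (Suc r)
  have "measure_pmf.expectation (union_pmf \<nu> (Suc r)) h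
      = measure_pmf.expectation (union_pmf \<nu> r) (\<lambda>W. measure_pmf.expectation \<nu> (\<lambda>S. h (S \<union> W)))"
    by (rule expectation_union_pmf_Suc[OF finite_set_node])
  also have "\<dots> \<le> measure_pmf.expectation (union_pmf \<nu> r) (\<lambda>W. measure_pmf.expectation \<kappa> (\<lambda>S. h (S \<union> W)))"
  proof (rule expectation_mono_pmf_finite)
    fix W assume W: "W \<in> set_pmf (union_pmf \<nu> r)"
    have "W \<subseteq> {..<P}"
      by (rule set_union_pmf_subset[OF set_node_subset W])
    then show "measure_pmf.expectation \<nu> (\<lambda>S. h (S \<union> W)) \<le> measure_pmf.expectation \<kappa> (\<lambda>S. h (S \<union> W))"
      by (intro expectation_node_le_least Suc.prems) auto
  qed (simp add: finite_set_union_pmf finite_set_node)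
  also have "\<dots> \<le> measure_pmf.expectation (union_pmf \<kappa> r) (\<lambda>W. measure_pmf.expectation \<kappa> (\<lambda>S. h (S \<union> W)))"
  proof (rule Suc.IH)
    fix S T :: "nat set" assume ST: "S \<subseteq> T" "T \<subseteq> {..<P}"
    show "measure_pmf.expectation \<kappa> (\<lambda>U. h (U \<union> T)) \<le> measure_pmf.expectation \<kappa> (\<lambda>U. h (U \<union> S))"
    proof (rule expectation_mono_pmf_finite[OF finite_set_least])
      fix U assume "U \<in> set_pmf \<kappa>"
      with ST show "h (U \<union> T) \<le> h (U \<union> S)"
        using set_least_subset[of U] by (intro Suc.prems) auto
    qed
  qed
  also have "\<dots> = measure_pmf.expectation (union_pmf \<kappa> (Suc r)) h"
    by (rule expectation_union_pmf_Suc[OF finite_set_least, symmetric])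
  finally show ?case .
qed simp

section \<open>Cuts of the random graph\<close>

definition cut_term :: "nat \<Rightarrow> nat \<Rightarrow> real" where
  "cut_term n r = real (n choose r)
    * measure_pmf.expectation (union_pmf \<kappa> r) (\<lambda>W. avoid (card W) ^ (n - r))"

abbreviation assignment :: "nat \<Rightarrow> (nat \<Rightarrow> nat set) pmf" where
  "assignment n \<equiv> Pi_pmf {1..n} {} (\<lambda>_. \<nu>)"

lemma finite_set_assignment: "finite T \<Longrightarrow> finite (set_pmf (Pi_pmf T {} (\<lambda>_. \<nu>)))"
  by (intro finite_set_Pi_pmf finite_set_node)

lemma assignment_subset:
  assumes "finite T" "f \<in> set_pmf (Pi_pmf T {} (\<lambda>_. \<nu>))" "v \<in> T"
  shows "f v \<subseteq> {..<P}"
  using assms by (auto simp: set_Pi_pmf PiE_dflt_def dest: set_node_subset)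

lemma prob_connected_eq:
  "prob_connected n m a K P
    = measure_pmf.prob (assignment n) {S. Digraph_Component.connected (with_proj (key_graph {1..n} S))}"
  by (simp add: prob_connected_def het_random_key_graph_def vimage_def)

text \<open>Only the sets inside \<open>T\<close> shrink to the least size; the nodes outside keep
  the law \<open>\<nu>\<close>, so \<open>avoid\<close> still averages over all groups.\<close>

lemma prob_cut_le:
  assumes T: "T \<subseteq> {1..n}"
  shows "measure_pmf.prob (assignment n) {S. \<forall>v\<in>T. \<forall>w\<in>{1..n} - T. S v \<inter> S w = {}}
    \<le> measure_pmf.expectation (union_pmf \<kappa> (card T)) (\<lambda>W. avoid (card W) ^ (n - card T))"
proof -
  have fin: "finite T" using T finite_subset by blast
  have "measure_pmf.prob (assignment n) {S. \<forall>v\<in>T. \<forall>w\<in>{1..n} - T. S v \<inter> S w = {}}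
      = measure_pmf.expectation (Pi_pmf T {} (\<lambda>_. \<nu>))
          (\<lambda>f. measure_pmf.prob \<nu> {S. S \<inter> \<Union>(f ` T) = {}} ^ card ({1..n} - T))"
    using prob_Pi_pmf_cut[OF _ T finite_set_node, of "\<lambda>_. True" "{}"] by simp
  also have "\<dots> = measure_pmf.expectation (map_pmf (\<lambda>f. \<Union>(f ` T)) (Pi_pmf T {} (\<lambda>_. \<nu>)))
          (\<lambda>W. measure_pmf.prob \<nu> {S. S \<inter> W = {}} ^ (n - card T))"
    using T fin by (simp add: card_Diff_subset)
  also have "\<dots> = measure_pmf.expectation (union_pmf \<nu> (card T))
          (\<lambda>W. measure_pmf.prob \<nu> {S. S \<inter> W = {}} ^ (n - card T))"
    unfolding map_Union_Pi_pmf[OF fin] ..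
  also have "\<dots> \<le> measure_pmf.expectation (union_pmf \<nu> (card T)) (\<lambda>W. avoid (card W) ^ (n - card T))"
  proof (rule expectation_mono_pmf_finite)
    fix W assume W: "W \<in> set_pmf (union_pmf \<nu> (card T))"
    have "W \<subseteq> {..<P}" by (rule set_union_pmf_subset[OF set_node_subset W])
    then show "measure_pmf.prob \<nu> {S. S \<inter> W = {}} ^ (n - card T) \<le> avoid (card W) ^ (n - card T)"
      by (simp add: prob_node_avoid)
  qed (simp add: finite_set_union_pmf finite_set_node)
  also have "\<dots> \<le> measure_pmf.expectation (union_pmf \<kappa> (card T)) (\<lambda>W. avoid (card W) ^ (n - card T))"
  proof (rule expectation_union_node_le_least)
    fix S T' :: "nat set" assume ST: "S \<subseteq> T'" "T' \<subseteq> {..<P}"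
    have "finite T'" using ST(2) by (rule finite_subset) simp
    then have "card S \<le> card T'" using ST(1) by (rule card_mono)
    then show "avoid (card T') ^ (n - card T) \<le> avoid (card S) ^ (n - card T)"
      by (intro power_mono avoid_antimono avoid_nonneg)
  qed
  finally show ?thesis .
qed

lemma prob_disconnected_le:
  assumes "1 \<le> n"
  shows "1 - prob_connected n m a K P \<le> (\<Sum>r = 1..n div 2. cut_term n r)"
proof -
  define C where "C T = {S :: nat \<Rightarrow> nat set. \<forall>v\<in>T. \<forall>w\<in>{1..n} - T. S v \<inter> S w = {}}" for T
  define Ts where "Ts r = {T. T \<subseteq> {1..n} \<and> card T = r}" for r
  have finTs: "finite (Ts r)" for r by (simp add: Ts_def)
  have cardTs: "card (Ts r) = n choose r" for r by (simp add: Ts_def n_subsets)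
  let ?D = "{S :: nat \<Rightarrow> nat set. \<not> Digraph_Component.connected (with_proj (key_graph {1..n} S))}"
  have "1 - prob_connected n m a K P = measure_pmf.prob (assignment n) ?D"
    unfolding prob_connected_eq by (subst measure_pmf.prob_compl[symmetric]) (auto intro!: arg_cong[where f = "measure_pmf.prob _"])
  also have "\<dots> \<le> measure_pmf.prob (assignment n) (\<Union>r\<in>{1..n div 2}. \<Union>T\<in>Ts r. C T)"
  proof (rule measure_pmf.finite_measure_mono)
    show "?D \<subseteq> (\<Union>r\<in>{1..n div 2}. \<Union>T\<in>Ts r. C T)"
    proof
      fix S :: "nat \<Rightarrow> nat set" assume "S \<in> ?D"
      then obtain T where "T \<subseteq> {1..n}" "1 \<le> card T" "2 * card T \<le> n"
        "\<And>v w. v \<in> T \<Longrightarrow> w \<in> {1..n} - T \<Longrightarrow> S v \<inter> S w = {}"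
        using not_connected_obtains_cut[OF assms, of S] by (metis (no_types, lifting) mem_Collect_eq)
      then have "card T \<in> {1..n div 2}" "T \<in> Ts (card T)" "S \<in> C T"
        by (auto simp: Ts_def C_def)
      then show "S \<in> (\<Union>r\<in>{1..n div 2}. \<Union>T\<in>Ts r. C T)" by blast
    qed
  qed simp
  also have "\<dots> \<le> (\<Sum>r = 1..n div 2. measure_pmf.prob (assignment n) (\<Union>T\<in>Ts r. C T))"
    by (intro measure_pmf.finite_measure_subadditive_finite) auto
  also have "\<dots> \<le> (\<Sum>r = 1..n div 2. \<Sum>T\<in>Ts r. measure_pmf.prob (assignment n) (C T))"
    by (intro sum_mono measure_pmf.finite_measure_subadditive_finite finTs) auto
  also have "\<dots> \<le> (\<Sum>r = 1..n div 2. \<Sum>T\<in>Ts r.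
      measure_pmf.expectation (union_pmf \<kappa> r) (\<lambda>W. avoid (card W) ^ (n - r)))"
    using prob_cut_le by (intro sum_mono) (auto simp: C_def Ts_def)
  also have "\<dots> = (\<Sum>r = 1..n div 2. cut_term n r)"
    by (simp add: cut_term_def cardTs)
  finally show ?thesis .
qed

subsection \<open>Isolated nodes\<close>

text \<open>Here \<open>x j\<close> is the chance that a node of group \<open>j\<close> meets a
  given set of \<open>K 1\<close> keys. Log-concavity gives independence within a group; across
  groups the mean of \<open>(x j)^2\<close> exceeds \<open>b^2\<close>, but
  \<open>a j * x j <= b\<close> limits it to \<open>b^2\<close> times the sum of
  \<open>1 / a j\<close>.\<close>

lemma avoid_double_le:
  assumes "2 * K 1 \<le> P"
  defines "b \<equiv> 1 - avoid (K 1)"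
  shows "avoid (2 * K 1) \<le> (1 - b)\<^sup>2 + (\<Sum>j = 1..m. 1 / a j) * b\<^sup>2"
proof -
  define x where "x j = 1 - real ((P - K 1) choose K j) / real (P choose K j)" for j
  have x_nonneg: "0 \<le> x j" if "j \<in> {1..m}" for j
    using choose_pos[OF that] binomial_right_mono[of "P - K 1" P "K j"]
    by (simp add: x_def divide_le_eq)
  have b: "b = (\<Sum>j = 1..m. a j * x j)"
    by (simp add: b_def avoid_def x_def right_diff_distrib sum_subtractf a_sum)
  have "avoid (2 * K 1) \<le> (\<Sum>j = 1..m. a j * (1 - x j)\<^sup>2)"
    unfolding avoid_def
  proof (intro sum_mono mult_left_mono)
    fix j assume j: "j \<in> {1..m}"
    have "real ((P - 2 * K 1) choose K j) / real (P choose K j)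
        = real ((P - 2 * K 1) choose K j) * real (P choose K j) / (real (P choose K j))\<^sup>2"
      using choose_pos[OF j] by (simp add: power2_eq_square)
    also have "\<dots> \<le> (real ((P - K 1) choose K j))\<^sup>2 / (real (P choose K j))\<^sup>2"
      using binomial_log_concave[OF assms(1)] by (intro divide_right_mono) auto
    finally show "real ((P - 2 * K 1) choose K j) / real (P choose K j) \<le> (1 - x j)\<^sup>2"
      by (simp add: x_def power_divide)
    show "0 \<le> a j" using a_pos[OF j] by simp
  qed
  also have "\<dots> = (\<Sum>j = 1..m. a j - 2 * (a j * x j) + a j * (x j)\<^sup>2)"
    by (intro sum.cong) (auto simp: power2_eq_square algebra_simps)
  also have "\<dots> = 1 - 2 * b + (\<Sum>j = 1..m. a j * (x j)\<^sup>2)"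
    by (simp add: sum.distrib sum_subtractf b sum_distrib_left[symmetric] a_sum)
  also have "(\<Sum>j = 1..m. a j * (x j)\<^sup>2) \<le> (\<Sum>j = 1..m. 1 / a j * b\<^sup>2)"
  proof (rule sum_mono)
    fix j assume j: "j \<in> {1..m}"
    have "a j * x j \<le> b"
      unfolding b using j a_pos x_nonneg by (intro member_le_sum) (auto simp: less_imp_le)
    then have "(a j * x j)\<^sup>2 \<le> b\<^sup>2"
      using a_pos[OF j] x_nonneg[OF j] by (intro power_mono) auto
    then show "a j * (x j)\<^sup>2 \<le> 1 / a j * b\<^sup>2"
      using a_pos[OF j] by (simp add: field_simps power2_eq_square)
  qed
  also have "1 - 2 * b + (\<Sum>j = 1..m. 1 / a j * b\<^sup>2) \<le> (1 - b)\<^sup>2 + (\<Sum>j = 1..m. 1 / a j) * b\<^sup>2"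
    unfolding sum_distrib_right[symmetric] by (simp add: power2_eq_square algebra_simps)
  finally show ?thesis by simp
qed

text \<open>Fixing the size \<open>K 1\<close> gives all the isolation events one common
  probability, and two disjoint sets of that size occupy exactly \<open>2 * K 1\<close>
  keys.\<close>

lemma prob_connected_le_second_moment:
  assumes n: "2 \<le> n" and "2 * K 1 \<le> P" and pos: "0 < avoid (K 1)"
  shows "prob_connected n m a K P \<le> 1 / (real n * (a 1 * avoid (K 1) ^ (n - 1)))
    + avoid (2 * K 1) ^ (n - 2) / avoid (K 1) ^ (2 * (n - 1)) - 1"
proof -
  \<comment> \<open>This can exceed \<open>a 1\<close>, since further groups may have the same size.
    It cancels in \<open>Q / q^2\<close>, so \<open>a 1\<close> has to replace it in the first term
    only.\<close>
  define \<alpha> where "\<alpha> = measure_pmf.prob \<nu> {S. card S = K 1}"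
  define q where "q = \<alpha> * avoid (K 1) ^ (n - 1)"
  define Q where "Q = \<alpha>\<^sup>2 * avoid (2 * K 1) ^ (n - 2)"
  define A where "A v = {f :: nat \<Rightarrow> nat set. card (f v) = K 1 \<and> (\<forall>x\<in>{v}. \<forall>w\<in>{1..n} - {v}. f x \<inter> f w = {})}" for v
  have "a 1 \<le> \<alpha>"
  proof -
    have "\<alpha> = measure_pmf.expectation \<nu> (indicator {S. card S = K 1})"
      by (simp add: \<alpha>_def)
    also have "\<dots> = (\<Sum>j = 1..m. a j * measure_pmf.prob (pmf_of_set (key_sets P (K j))) {S. card S = K 1})"
      unfolding expectation_node by simp
    also have "\<dots> \<ge> a 1 * measure_pmf.prob \<kappa> {S. card S = K 1}"
      using m a_pos by (intro member_le_sum) (auto simp: less_imp_le)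
    moreover have "measure_pmf.prob \<kappa> {S. card S = K 1} = 1"
      by (subst measure_pmf.prob_eq_1) (simp_all add: AE_measure_pmf_iff set_least, simp add: key_sets_def)
    ultimately show ?thesis by simp
  qed
  moreover have a1: "0 < a 1" using a_pos m by auto
  ultimately have \<alpha>: "0 < \<alpha>" by simp
  have q: "0 < q" using \<alpha> pos by (simp add: q_def)
  have Q: "0 \<le> Q" by (simp add: Q_def avoid_nonneg)
  have single: "measure_pmf.prob (assignment n) (A v) = q" if v: "v \<in> {1..n}" for v
  proof -
    have "measure_pmf.prob (assignment n) (A v) = measure_pmf.expectation (Pi_pmf {v} {} (\<lambda>_. \<nu>))
        (\<lambda>f. of_bool (card (f v) = K 1) * measure_pmf.prob \<nu> {S. S \<inter> \<Union>(f ` {v}) = {}} ^ card ({1..n} - {v}))"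
      unfolding A_def using v by (intro prob_Pi_pmf_cut finite_set_node) auto
    also have "\<dots> = measure_pmf.expectation (map_pmf (\<lambda>f. f v) (Pi_pmf {v} {} (\<lambda>_. \<nu>)))
        (\<lambda>W. of_bool (card W = K 1) * measure_pmf.prob \<nu> {S. S \<inter> W = {}} ^ (n - 1))"
      using v by simp
    also have "\<dots> = measure_pmf.expectation \<nu>
        (\<lambda>W. of_bool (card W = K 1) * measure_pmf.prob \<nu> {S. S \<inter> W = {}} ^ (n - 1))"
      by (simp only: Pi_pmf_component finite.emptyI finite.insertI insertI1 if_True)
    also have "\<dots> = measure_pmf.expectation \<nu> (\<lambda>W. indicator {S. card S = K 1} W * avoid (K 1) ^ (n - 1))"
    proof (rule integral_cong_AE)
      show "AE W in \<nu>. of_bool (card W = K 1) * measure_pmf.prob \<nu> {S. S \<inter> W = {}} ^ (n - 1)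
          = indicator {S. card S = K 1} W * avoid (K 1) ^ (n - 1)"
        using prob_node_avoid set_node_subset by (auto simp: AE_measure_pmf_iff)
    qed auto
    also have "\<dots> = q" by (simp add: q_def \<alpha>_def)
    finally show ?thesis .
  qed
  have pair: "measure_pmf.prob (assignment n) (A v \<inter> A w) \<le> Q"
    if v: "v \<in> {1..n}" and w: "w \<in> {1..n}" and "v \<noteq> w" for v w
  proof -
    let ?T = "{v, w}"
    let ?c = "\<lambda>f :: nat \<Rightarrow> nat set. card (f v) = K 1 \<and> card (f w) = K 1 \<and> f v \<inter> f w = {}"
    have "measure_pmf.prob (assignment n) (A v \<inter> A w)
        \<le> measure_pmf.prob (assignment n) {f. ?c f \<and> (\<forall>x\<in>?T. \<forall>y\<in>{1..n} - ?T. f x \<inter> f y = {})}"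
      using that by (intro measure_pmf.finite_measure_mono) (auto simp: A_def)
    also have "\<dots> = measure_pmf.expectation (Pi_pmf ?T {} (\<lambda>_. \<nu>))
        (\<lambda>f. of_bool (?c f) * measure_pmf.prob \<nu> {S. S \<inter> \<Union>(f ` ?T) = {}} ^ card ({1..n} - ?T))"
      using v w by (intro prob_Pi_pmf_cut finite_set_node) auto
    \<comment> \<open>Disjointness of the two sets serves to compute the size of their union and is
      then dropped, which leaves independent size conditions.\<close>
    also have "\<dots> \<le> measure_pmf.expectation (Pi_pmf ?T {} (\<lambda>_. \<nu>))
        (\<lambda>f. indicator (Pi ?T (\<lambda>_. {S. card S = K 1})) f * avoid (2 * K 1) ^ (n - 2))"
    proof (rule expectation_mono_pmf_finite[OF finite_set_assignment])
      fix f assume f: "f \<in> set_pmf (Pi_pmf ?T {} (\<lambda>_. \<nu>))"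
      have sub: "f v \<subseteq> {..<P}" "f w \<subseteq> {..<P}"
        using assignment_subset[OF _ f] by auto
      show "of_bool (?c f) * measure_pmf.prob \<nu> {S. S \<inter> \<Union>(f ` ?T) = {}} ^ card ({1..n} - ?T)
          \<le> indicator (Pi ?T (\<lambda>_. {S. card S = K 1})) f * avoid (2 * K 1) ^ (n - 2)"
      proof (cases "?c f")
        case True
        have "card (f v \<union> f w) = 2 * K 1"
          using True sub finite_subset[OF sub(1)] finite_subset[OF sub(2)] by (simp add: card_Un_disjoint)
        moreover have "\<Union>(f ` ?T) = f v \<union> f w" by auto
        ultimately have "measure_pmf.prob \<nu> {S. S \<inter> \<Union>(f ` ?T) = {}} = avoid (2 * K 1)"
          using sub prob_node_avoid[of "f v \<union> f w"] by simp
        moreover have "card ({1..n} - ?T) = n - 2"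
          using that by (simp add: card_Diff_subset)
        ultimately show ?thesis using True by simp
      next
        case False
        then have "of_bool (?c f) = (0 :: real)" by (simp only: of_bool_def if_False)
        then show ?thesis by (simp only: mult_zero_left) (simp add: avoid_nonneg)
      qed
    qed simp
    also have "\<dots> = measure_pmf.prob (Pi_pmf ?T {} (\<lambda>_. \<nu>)) (Pi ?T (\<lambda>_. {S. card S = K 1})) * avoid (2 * K 1) ^ (n - 2)"
      by simp
    also have "\<dots> = Q"
      using \<open>v \<noteq> w\<close> by (subst measure_Pi_pmf_Pi) (simp_all add: Q_def \<alpha>_def power2_eq_square)
    finally show ?thesis .
  qed
  have "prob_connected n m a K P \<le> measure_pmf.prob (assignment n) (- (\<Union>v\<in>{1..n}. A v))"
    unfolding prob_connected_eq
  proof (rule measure_pmf.finite_measure_mono)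
    show "{S. Digraph_Component.connected (with_proj (key_graph {1..n} S))} \<subseteq> - (\<Union>v\<in>{1..n}. A v)"
    proof (intro subsetI ComplI)
      fix S :: "nat \<Rightarrow> nat set" assume S: "S \<in> {S. Digraph_Component.connected (with_proj (key_graph {1..n} S))}"
      assume "S \<in> (\<Union>v\<in>{1..n}. A v)"
      then obtain v where v: "v \<in> {1..n}" "S \<in> A v" by blast
      then have "S v \<inter> S w = {}" if "w \<in> {1..n} - {v}" for w
        using that unfolding A_def by blast
      then show False using isolated_not_connected[OF n v(1), of S] S by blast
    qed
  qed simp
  also have "\<dots> \<le> 1 / (real (card {1..n}) * q) + Q / q\<^sup>2 - 1"
    using n q Q single pair
    by (intro prob_none_le_second_moment finite_set_assignment) auto
  also have "1 / (real (card {1..n}) * q) \<le> 1 / (real n * (a 1 * avoid (K 1) ^ (n - 1)))"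
  proof -
    have "0 < real n * (a 1 * avoid (K 1) ^ (n - 1))"
      using n a1 pos by simp
    moreover have "real n * (a 1 * avoid (K 1) ^ (n - 1)) \<le> real (card {1..n}) * q"
      using \<open>a 1 \<le> \<alpha>\<close> pos by (simp add: q_def mult_right_mono mult_left_mono)
    ultimately show ?thesis by (intro divide_left_mono mult_pos_pos) (use q n a1 pos in auto)
  qed
  also have "Q / q\<^sup>2 = avoid (2 * K 1) ^ (n - 2) / avoid (K 1) ^ (2 * (n - 1))"
    using \<alpha> by (simp add: Q_def q_def power_mult_distrib power_mult[symmetric] mult.commute)
  finally show ?thesis by simp
qed

end

subsection \<open>Bounding the cut terms\<close>

text \<open>Follows from \<open>exp (- y) <= 1 / (1 + y) <= 1 - y + y^2\<close>. Linearity in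
  \<open>y\<close> is the point: averaged over the groups, the bound becomes a multiple of
  \<open>edge_rate\<close>.\<close>

lemma exp_minus_le_linear:
  fixes y \<epsilon> :: real
  assumes "0 \<le> y" "y \<le> \<epsilon>"
  shows "exp (- y) \<le> 1 - y * (1 - \<epsilon>)"
proof -
  have "1 + y \<le> exp y" by (rule exp_ge_add_one_self)
  then have "exp (- y) \<le> 1 / (1 + y)"
    using assms by (simp add: exp_minus inverse_eq_divide frac_le)
  also have "\<dots> \<le> 1 - y + y * y"
  proof -
    have "1 \<le> 1 + y * y * y" using assms by simp
    also have "\<dots> = (1 - y + y * y) * (1 + y)" by (simp add: algebra_simps)
    finally show ?thesis using assms by (simp add: divide_le_eq)
  qed
  also have "\<dots> \<le> 1 - y * (1 - \<epsilon>)"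
    using mult_left_mono[OF assms(2,1)] by (simp add: algebra_simps)
  finally show ?thesis .
qed

section \<open>Linearized bounds on the avoidance probability\<close>

context het_keys
begin

text \<open>First-order value of the edge probability of a node of group 1.\<close>

definition edge_rate :: real where
  "edge_rate = (\<Sum>j = 1..m. a j * (real (K 1) * real (K j) / real P))"

text \<open>The direction that the one law needs: \<beta> is defined through the exact edge
  probability, and lower bounds on \<beta> pass to the linearized rate.\<close>

lemma one_minus_avoid_le: "1 - avoid (K 1) \<le> edge_rate"
proof -
  have "1 - edge_rate = (\<Sum>j = 1..m. a j * (1 - real (K 1) * real (K j) / real P))"
    by (simp add: edge_rate_def right_diff_distrib sum_subtractf a_sum)
  also have "\<dots> \<le> avoid (K 1)"
    unfolding avoid_def
  proof (intro sum_mono mult_left_mono)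
    fix j assume j: "j \<in> {1..m}"
    then show "1 - real (K 1) * real (K j) / real P \<le> real ((P - K 1) choose K j) / real (P choose K j)"
      using binomial_diff_ge[of "K j" P "K 1"] K_bounds[OF j] K1 choose_pos[OF j]
      by (simp add: le_divide_eq)
    show "0 \<le> a j" using a_pos[OF j] by simp
  qed
  finally show ?thesis by simp
qed

lemma least_le_edge_rate: "(real (K 1))\<^sup>2 / real P \<le> edge_rate"
proof -
  have "(real (K 1))\<^sup>2 / real P = (\<Sum>j = 1..m. a j * ((real (K 1))\<^sup>2 / real P))"
    by (simp only: sum_distrib_right[symmetric] a_sum mult_1_left)
  also have "\<dots> \<le> edge_rate"
    unfolding edge_rate_def
  proof (intro sum_mono mult_left_mono)
    fix j assume j: "j \<in> {1..m}"
    show "(real (K 1))\<^sup>2 / real P \<le> real (K 1) * real (K j) / real P"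
      using K_mono[of 1 j] j by (intro divide_right_mono) (auto simp: power2_eq_square mult_left_mono)
    show "0 \<le> a j" using a_pos[OF j] by simp
  qed
  finally show ?thesis .
qed

lemma edge_rate_pos: "0 < edge_rate"
  using least_le_edge_rate K1 P_pos by (smt (verit) divide_pos_pos of_nat_0_less_iff zero_less_power not_one_le_zero gr0I)

lemma am_pos: "0 < a m"
  using a_pos m by auto

text \<open>The summand of group \<open>m\<close> alone; its fixed weight lets the edge rate control
  the largest key sets.\<close>

lemma largest_le_edge_rate: "real (K 1) * real (K m) / real P \<le> edge_rate / a m"
proof -
  have "a m * (real (K 1) * real (K m) / real P) \<le> edge_rate"
    unfolding edge_rate_def using m a_pos by (intro member_le_sum) (auto simp: less_imp_le)
  then show ?thesis using am_pos by (simp add: field_simps)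
qed

text \<open>The real number \<open>y\<close> stands for a guaranteed number of keys and need not be
  an integer.\<close>

lemma avoid_le_exp_sum:
  assumes "y \<le> real u" "u \<le> P"
  shows "avoid u \<le> (\<Sum>j = 1..m. a j * exp (- (y * real (K j) / real P)))"
  unfolding avoid_def
proof (intro sum_mono mult_left_mono)
  fix j assume j: "j \<in> {1..m}"
  have "real ((P - u) choose K j) / real (P choose K j) \<le> (real (P - u) / real P) ^ K j"
    using binomial_le_power_ratio[of "P - u" P "K j"] choose_pos[OF j] by (simp add: divide_le_eq)
  also have "real (P - u) / real P = 1 - real u / real P"
    using assms P_pos by (simp add: of_nat_diff diff_divide_distrib)
  also have "(1 - real u / real P) ^ K j \<le> exp (- (real u / real P)) ^ K j"
    using exp_ge_add_one_self[of "- (real u / real P)"] assms P_pos by (intro power_mono) auto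
  also have "\<dots> = exp (- (real u * real (K j) / real P))"
    by (simp add: exp_of_nat_mult[symmetric] mult.commute)
  also have "\<dots> \<le> exp (- (y * real (K j) / real P))"
    using assms by (simp add: divide_right_mono mult_right_mono)
  finally show "real ((P - u) choose K j) / real (P choose K j) \<le> exp (- (y * real (K j) / real P))" .
  show "0 \<le> a j" using a_pos[OF j] by simp
qed

lemma avoid_le_exp_least:
  assumes "0 \<le> y" "y \<le> real u" "u \<le> P"
  shows "avoid u \<le> exp (- (y * real (K 1) / real P))"
proof -
  have "avoid u \<le> (\<Sum>j = 1..m. a j * exp (- (y * real (K j) / real P)))"
    by (rule avoid_le_exp_sum[OF assms(2,3)])
  also have "\<dots> \<le> (\<Sum>j = 1..m. a j * exp (- (y * real (K 1) / real P)))"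
  proof (intro sum_mono mult_left_mono)
    fix j assume j: "j \<in> {1..m}"
    then show "exp (- (y * real (K j) / real P)) \<le> exp (- (y * real (K 1) / real P))"
      using K_mono[of 1 j] assms by (simp add: divide_right_mono mult_left_mono)
    show "0 \<le> a j" using a_pos[OF j] by simp
  qed
  finally show ?thesis by (simp only: sum_distrib_right[symmetric] a_sum mult_1_left)
qed

text \<open>The keys count as \<open>y / K 1\<close> nodes of group 1, up to the factor
  \<open>1 - \<epsilon>\<close>. The condition on \<open>K m\<close> keeps the exponents of all
  groups in the linear range.\<close>

lemma avoid_le_exp_edge_rate:
  assumes "0 \<le> y" "y \<le> real u" "u \<le> P" "y * real (K m) / real P \<le> \<epsilon>"
  shows "avoid u \<le> exp (- (y / real (K 1) * edge_rate * (1 - \<epsilon>)))"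
proof -
  have "avoid u \<le> (\<Sum>j = 1..m. a j * exp (- (y * real (K j) / real P)))"
    by (rule avoid_le_exp_sum[OF assms(2,3)])
  also have "\<dots> \<le> (\<Sum>j = 1..m. a j * (1 - y * real (K j) / real P * (1 - \<epsilon>)))"
  proof (intro sum_mono mult_left_mono exp_minus_le_linear)
    fix j assume j: "j \<in> {1..m}"
    have "y * real (K j) / real P \<le> y * real (K m) / real P"
      using K_mono[of j m] j assms by (intro divide_right_mono mult_left_mono) auto
    then show "y * real (K j) / real P \<le> \<epsilon>" using assms by simp
    show "0 \<le> a j" using a_pos[OF j] by simp
  qed (use assms in auto)
  also have "\<dots> = 1 - (\<Sum>j = 1..m. a j * (y * real (K j) / real P * (1 - \<epsilon>)))"
    by (simp add: right_diff_distrib sum_subtractf a_sum)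
  also have "(\<Sum>j = 1..m. a j * (y * real (K j) / real P * (1 - \<epsilon>))) = y / real (K 1) * edge_rate * (1 - \<epsilon>)"
    unfolding edge_rate_def sum_distrib_left sum_distrib_right using K1 P_pos
    by (intro sum.cong) (simp_all add: field_simps)
  also have "1 - \<dots> \<le> exp (- (y / real (K 1) * edge_rate * (1 - \<epsilon>)))"
    using exp_ge_add_one_self[of "- (y / real (K 1) * edge_rate * (1 - \<epsilon>))"] by simp
  finally show ?thesis .
qed

text \<open>All groups but the last are given the trivial bound 1; the constant weight
  \<open>a m\<close> still yields a constant gain.\<close>

lemma avoid_le_exp_largest:
  assumes "0 \<le> y" "y \<le> real u" "u \<le> P" "\<epsilon> \<le> y * real (K m) / real P"
  shows "avoid u \<le> exp (- (a m * (1 - exp (- \<epsilon>))))"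
proof -
  have "avoid u \<le> (\<Sum>j = 1..m. a j * exp (- (y * real (K j) / real P)))"
    by (rule avoid_le_exp_sum[OF assms(2,3)])
  also have "\<dots> \<le> (\<Sum>j = 1..m. a j - (if j = m then a m * (1 - exp (- \<epsilon>)) else 0))"
  proof (rule sum_mono)
    fix j assume j: "j \<in> {1..m}"
    show "a j * exp (- (y * real (K j) / real P)) \<le> a j - (if j = m then a m * (1 - exp (- \<epsilon>)) else 0)"
    proof (cases "j = m")
      case True
      then show ?thesis using assms am_pos by (simp add: algebra_simps)
    next
      case False
      have "exp (- (y * real (K j) / real P)) \<le> 1" using assms by simp
      then show ?thesis using False a_pos[OF j] by (simp add: mult_left_le)
    qed
  qed
  also have "\<dots> = 1 - a m * (1 - exp (- \<epsilon>))"
    using m by (simp add: sum_subtractf a_sum)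
  also have "\<dots> \<le> exp (- (a m * (1 - exp (- \<epsilon>))))"
    using exp_ge_add_one_self[of "- (a m * (1 - exp (- \<epsilon>)))"] by simp
  finally show ?thesis .
qed

lemma card_union_least_le:
  assumes "W \<in> set_pmf (union_pmf \<kappa> r)"
  shows "card W \<le> r * K 1" "card W \<le> P"
proof -
  show "card W \<le> r * K 1"
    by (rule card_union_pmf_le[OF _ assms]) (unfold set_least, simp add: key_sets_def)
  have "W \<subseteq> {..<P}" by (rule set_union_pmf_subset[OF set_least_subset assms])
  then show "card W \<le> P" using card_mono[of "{..<P}" W] by simp
qed

text \<open>Since a union has at most \<open>r * K 1\<close> keys, linearization is valid for all of
  them with the common error \<open>r * edge_rate / a m\<close>. The power of \<open>avoid\<close>
  is then exponential in the union size with rate \<open>\<theta>\<close>.\<close>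

lemma cut_term_le_exp_moment:
  assumes "r \<le> n" "real r * edge_rate / a m \<le> 1"
  defines "\<theta> \<equiv> real (n - r) * edge_rate * (1 - real r * edge_rate / a m) / real (K 1)"
  shows "cut_term n r \<le> real n ^ r * exp (real r * (- \<theta> * real (K 1) + real r * exp \<theta> * (real (K 1))\<^sup>2 / real P))"
proof -
  have \<theta>: "0 \<le> \<theta>" using assms edge_rate_pos by simp
  have "measure_pmf.expectation (union_pmf \<kappa> r) (\<lambda>W. avoid (card W) ^ (n - r))
      \<le> measure_pmf.expectation (union_pmf \<kappa> r) (\<lambda>W. exp (- \<theta> * real (card W)))"
  proof (rule expectation_mono_pmf_finite)
    fix W assume W: "W \<in> set_pmf (union_pmf \<kappa> r)"
    have "real (card W) \<le> real r * real (K 1)"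
      using card_union_least_le(1)[OF W] by (metis of_nat_le_iff of_nat_mult)
    then have "real (card W) * real (K m) / real P \<le> real r * real (K 1) * real (K m) / real P"
      by (intro divide_right_mono mult_right_mono) auto
    also have "\<dots> = real r * (real (K 1) * real (K m) / real P)" by simp
    also have "\<dots> \<le> real r * (edge_rate / a m)"
      by (intro mult_left_mono largest_le_edge_rate) simp
    finally have "real (card W) * real (K m) / real P \<le> real r * edge_rate / a m" by simp
    then have "avoid (card W) \<le> exp (- (real (card W) / real (K 1) * edge_rate * (1 - real r * edge_rate / a m)))"
      using card_union_least_le(2)[OF W] by (intro avoid_le_exp_edge_rate) auto
    then have "avoid (card W) ^ (n - r)
        \<le> exp (- (real (card W) / real (K 1) * edge_rate * (1 - real r * edge_rate / a m))) ^ (n - r)"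
      by (intro power_mono avoid_nonneg)
    also have "\<dots> = exp (- \<theta> * real (card W))"
      unfolding exp_of_nat_mult[symmetric] \<theta>_def by (simp add: field_simps)
    finally show "avoid (card W) ^ (n - r) \<le> exp (- \<theta> * real (card W))" .
  qed (simp add: finite_set_union_pmf finite_set_least)
  also have "\<dots> \<le> exp (real r * (- \<theta> * real (K 1) + real r * exp \<theta> * (real (K 1))\<^sup>2 / real P))"
    using K1 \<theta> by (intro expectation_exp_union_key_sets_le) auto
  finally have "measure_pmf.expectation (union_pmf \<kappa> r) (\<lambda>W. avoid (card W) ^ (n - r)) \<le> \<dots>" .
  moreover have "real (n choose r) \<le> real n ^ r"
    using binomial_le_pow[OF assms(1)] by (metis of_nat_le_iff of_nat_power)
  ultimately show ?thesis
    unfolding cut_term_def by (intro mult_mono) (auto intro!: integral_nonneg_AE simp: avoid_nonneg)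
qed

text \<open>In this range \<open>r * edge_rate <= \<delta> = 2 ln n / sqrt n\<close>. The
  \<open>r\<close> missing neighbours, the linearization and the overlaps each change the exponent
  per node by a multiple of \<open>\<delta>\<close>; together they cost at most 1, which is the 1 in
  \<open>exp (1 - \<beta>)\<close>.\<close>

lemma cut_term_small_le:
  assumes r: "1 \<le> r" "(real r)\<^sup>2 \<le> real n" and n: "2 \<le> n" and K8: "8 \<le> K 1"
    and rate: "real n * edge_rate \<le> 2 * ln (real n)" "ln (real n) + \<beta> \<le> real n * edge_rate"
    and large: "2 * ln (real n) / sqrt (real n) / a m \<le> 1"
      "2 * ln (real n) / sqrt (real n) * (1 + 2 * ln (real n) / a m + exp (ln (real n) / 4)) \<le> 1"
  shows "cut_term n r \<le> exp (1 - \<beta>) ^ r"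
proof -
  define l where "l = ln (real n)"
  define \<delta> where "\<delta> = 2 * l / sqrt (real n)"
  define x where "x = real r * edge_rate / a m"
  define \<theta> where "\<theta> = real (n - r) * edge_rate * (1 - x) / real (K 1)"
  have n0: "0 < real n" using n by simp
  have l: "0 \<le> l" using n by (simp add: l_def)
  have rs: "real r \<le> sqrt (real n)" using r by (intro real_le_rsqrt) auto
  have "real r * 1 \<le> real r * real r" using r by (intro mult_left_mono) auto
  with r(2) have rn: "r \<le> n" by (simp add: power2_eq_square)
  have "edge_rate \<le> 2 * l / real n" using rate n0 by (simp add: l_def field_simps)
  with rs have "real r * edge_rate \<le> sqrt (real n) * (2 * l / real n)"
    using edge_rate_pos by (intro mult_mono) auto
  also have "\<dots> = \<delta>" using n0 by (simp add: \<delta>_def field_simps)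
  finally have rl: "real r * edge_rate \<le> \<delta>" .
  have x_le: "x \<le> \<delta> / a m" unfolding x_def using rl am_pos by (intro divide_right_mono) auto
  moreover have "\<delta> / a m \<le> 1" using large(1) by (simp add: \<delta>_def l_def)
  ultimately have "x \<le> 1" by (rule order_trans)
  moreover have "0 \<le> x" using am_pos edge_rate_pos by (simp add: x_def)
  ultimately have x: "0 \<le> x" "x \<le> 1" by auto
  have \<theta>K: "\<theta> * real (K 1) = real (n - r) * edge_rate * (1 - x)"
    using K8 by (simp add: \<theta>_def)
  also have "\<dots> = (real n * edge_rate - real r * edge_rate) * (1 - x)"
    using rn by (simp add: of_nat_diff algebra_simps)
  also have "\<dots> = real n * edge_rate - real r * edge_rate - real n * edge_rate * x + real r * edge_rate * x"
    by (simp add: algebra_simps)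
  also have "\<dots> \<ge> real n * edge_rate - \<delta> - 2 * l * (\<delta> / a m)"
  proof -
    have "real n * edge_rate * x \<le> 2 * l * (\<delta> / a m)"
      by (rule mult_mono) (use rate x x_le l in \<open>auto simp: l_def\<close>)
    moreover have "0 \<le> real r * edge_rate * x" using x edge_rate_pos by simp
    ultimately show ?thesis using rl by linarith
  qed
  finally have lower: "real n * edge_rate - \<delta> - 2 * l * (\<delta> / a m) \<le> \<theta> * real (K 1)" .
  \<comment> \<open>Where \<open>8 <= K 1\<close> enters: \<open>\<theta> * K 1 <= 2 ln n\<close>
    then gives \<open>exp \<theta> <= n^(1/4)\<close>, a growth that \<open>\<delta>\<close> can
    absorb.\<close>
  have "\<theta> \<le> l / 4"
  proof -
    have "\<theta> * real (K 1) \<le> real n * edge_rate * 1"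
      unfolding \<theta>K using x edge_rate_pos by (intro mult_mono) auto
    also have "\<dots> \<le> 2 * l" using rate by (simp add: l_def)
    also have "\<dots> = l / 4 * 8" by simp
    also have "\<dots> \<le> l / 4 * real (K 1)" using K8 l by (intro mult_left_mono) auto
    finally show ?thesis using K8 by simp
  qed
  then have "real r * exp \<theta> * ((real (K 1))\<^sup>2 / real P) \<le> real r * exp (l / 4) * edge_rate"
    using least_le_edge_rate by (intro mult_mono) auto
  also have "\<dots> = real r * edge_rate * exp (l / 4)" by simp
  also have "\<dots> \<le> \<delta> * exp (l / 4)" using rl by (intro mult_right_mono) auto
  finally have upper: "real r * exp \<theta> * (real (K 1))\<^sup>2 / real P \<le> \<delta> * exp (l / 4)" by simp
  have "\<delta> * (1 + 2 * l / a m + exp (l / 4)) \<le> 1" using large(2) by (simp add: \<delta>_def l_def)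
  then have "\<delta> + 2 * l * (\<delta> / a m) + \<delta> * exp (l / 4) \<le> 1" by (simp add: algebra_simps)
  then have exponent: "l + (- \<theta> * real (K 1) + real r * exp \<theta> * (real (K 1))\<^sup>2 / real P) \<le> 1 - \<beta>"
    using lower upper rate by (simp add: l_def)
  have "cut_term n r \<le> real n ^ r * exp (real r * (- \<theta> * real (K 1) + real r * exp \<theta> * (real (K 1))\<^sup>2 / real P))"
    using cut_term_le_exp_moment[OF rn] x unfolding \<theta>_def x_def by simp
  also have "real n ^ r = exp (real r * l)"
    using n0 by (simp add: l_def exp_of_nat_mult)
  also have "exp (real r * l) * exp (real r * (- \<theta> * real (K 1) + real r * exp \<theta> * (real (K 1))\<^sup>2 / real P))
      = exp (real r * (l + (- \<theta> * real (K 1) + real r * exp \<theta> * (real (K 1))\<^sup>2 / real P)))"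
    by (simp only: exp_add[symmetric] distrib_left)
  also have "\<dots> \<le> exp (real r * (1 - \<beta>))"
    using exponent by (intro iffD2[OF exp_le_cancel_iff] mult_left_mono) auto
  also have "\<dots> = exp (1 - \<beta>) ^ r" by (simp only: exp_of_nat_mult)
  finally show ?thesis .
qed

text \<open>The probability that \<open>r\<close> key sets cover at most \<open>U\<close> keys is at most
  \<open>(e\<rho>\<^sup>\<delta>) ^ (r K\<^sub>1)\<close>, where \<open>\<rho> = U / P\<close> and \<open>\<delta> = 1/10\<close> is the missing fraction; the cutoff
  \<open>\<rho> \<le> exp (- 4 / \<delta>)\<close> makes this small enough to absorb the number of vertex sets, because
  \<open>n / r\<close> is at most \<open>K\<^sub>1 / (c \<rho>)\<close>.\<close>

lemma small_union_term_le:
  assumes r: "1 \<le> r" and c: "0 < c" "c * real n \<le> real P" and K20: "20 \<le> K 1"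
    and U: "real U \<le> 9/10 * (real r * real (K 1))" "real U \<le> exp (- 40) * real P"
  shows "real (n choose r) * measure_pmf.prob (union_pmf \<kappa> r) {W. card W \<le> U}
    \<le> (exp 1 * real (K 1) / c * exp (- real (K 1))) ^ r"
proof -
  have P0: "0 < real P" using P_pos by simp
  have K0: "0 < real (K 1)" using K1 by simp
  have UP: "U \<le> P"
  proof -
    have "exp (- 40) * real P \<le> 1 * real P" by (intro mult_right_mono) auto
    with U show ?thesis by simp
  qed
  have tail: "measure_pmf.prob (union_pmf \<kappa> r) {W. card W \<le> U}
      \<le> real (P choose U) * (real U / real P) ^ (r * K 1)"
    by (rule prob_union_key_sets_small_le[OF K1(2) UP])
  show ?thesis
  \<comment> \<open>\<open>ln (P / U)\<close> is meaningless for \<open>U = 0\<close>; in that case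
    the tail bound contains \<open>0 ^ (r * K 1) = 0\<close>.\<close>
  proof (cases "U = 0")
    case True
    then have "measure_pmf.prob (union_pmf \<kappa> r) {W. card W \<le> U} \<le> 0"
      using tail r K1 by (simp add: zero_power)
    then have "measure_pmf.prob (union_pmf \<kappa> r) {W. card W \<le> U} = 0"
      by (simp add: measure_le_0_iff)
    then show ?thesis using c by simp
  next
    case False
    then have U0: "0 < real U" by simp
    define L where "L = ln (real P / real U)"
    have expL: "exp L = real P / real U" using U0 P0 by (simp add: L_def)
    have "exp 40 \<le> real P / real U"
      using U(2) U0 by (simp add: exp_minus field_simps)
    then have L40: "40 \<le> L" using U0 P0 by (simp add: L_def ln_ge_iff)
    have r0: "0 < real r" using r by simp
    have "real (n choose r) \<le> (exp 1 * real n / real r) ^ r"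
      by (rule binomial_le_exp[OF r])
    also have "\<dots> \<le> (exp 1 * real (K 1) / c * exp L) ^ r"
    proof (intro power_mono)
      have "real U * (c * real n) \<le> (real r * real (K 1)) * real P"
        using U(1) c r0 K0 by (intro mult_mono) auto
      then have "real n / real r \<le> real (K 1) / c * exp L"
        unfolding expL using U0 c r0 by (simp add: field_simps)
      then have "exp 1 * (real n / real r) \<le> exp 1 * (real (K 1) / c * exp L)"
        by (intro mult_left_mono) auto
      then show "exp 1 * real n / real r \<le> exp 1 * real (K 1) / c * exp L" by simp
    qed simp
    finally have choose: "real (n choose r) \<le> (exp 1 * real (K 1) / c * exp L) ^ r" .
    have ratio: "real U / real P = exp (- L)" by (simp add: exp_minus expL)
    have "real (P choose U) * (real U / real P) ^ (r * K 1)
        \<le> (exp 1 * real P / real U) ^ U * (real U / real P) ^ (r * K 1)"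
      using False by (intro mult_right_mono binomial_le_exp) auto
    also have "exp 1 * real P / real U = exp (1 + L)" by (simp add: exp_add expL)
    also have "real U / real P = exp (- L)" by (rule ratio)
    also have "exp (1 + L) ^ U * exp (- L) ^ (r * K 1) = exp (real U * (1 + L) - real r * real (K 1) * L)"
      by (simp add: exp_of_nat_mult[symmetric] exp_add[symmetric] exp_diff exp_minus field_simps)
    also have "\<dots> \<le> exp (9/10 * (real r * real (K 1)) * (1 + L) - real r * real (K 1) * L)"
      using U(1) L40 by (intro iffD2[OF exp_le_cancel_iff] diff_right_mono mult_right_mono) auto
    also have "\<dots> = exp (real (K 1) * (9/10 - L / 10)) ^ r"
      unfolding exp_of_nat_mult[symmetric] by (simp add: algebra_simps)
    finally have tail': "measure_pmf.prob (union_pmf \<kappa> r) {W. card W \<le> U}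
        \<le> exp (real (K 1) * (9/10 - L / 10)) ^ r"
      using tail unfolding ratio by (rule order_trans[rotated])
    have "real (n choose r) * measure_pmf.prob (union_pmf \<kappa> r) {W. card W \<le> U}
        \<le> (exp 1 * real (K 1) / c * exp L) ^ r * exp (real (K 1) * (9/10 - L / 10)) ^ r"
      using c by (intro mult_mono choose tail') auto
    also have "\<dots> = (exp 1 * real (K 1) / c * exp (L + real (K 1) * (9/10 - L / 10))) ^ r"
      by (simp only: power_mult_distrib[symmetric] exp_add mult.assoc)
    also have "\<dots> \<le> (exp 1 * real (K 1) / c * exp (- real (K 1))) ^ r"
    proof (intro power_mono mult_left_mono iffD2[OF exp_le_cancel_iff])
      \<comment> \<open>The exponent decreases in \<open>L\<close>, and at \<open>L = 40\<close> it
        is \<open>40 - 3.1 * K 1\<close>, which is at most \<open>- K 1\<close> once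
        \<open>K 1 >= 20\<close>.\<close>
      have "40 * (real (K 1) / 10 - 1) \<le> L * (real (K 1) / 10 - 1)"
        using L40 K20 by (intro mult_right_mono) auto
      then show "L + real (K 1) * (9/10 - L / 10) \<le> - real (K 1)"
        using K20 by (simp add: algebra_simps)
    qed (use c in auto)
    finally show ?thesis .
  qed
qed

section \<open>Assembling the bound on a cut term\<close>

lemma cut_term_split_le:
  assumes "\<And>u. U < u \<Longrightarrow> u \<le> P \<Longrightarrow> avoid u \<le> g" "0 \<le> g"
  shows "cut_term n r \<le> real (n choose r) * measure_pmf.prob (union_pmf \<kappa> r) {W. card W \<le> U}
    + real (n choose r) * g ^ (n - r)"
proof -
  have fin: "finite (set_pmf (union_pmf \<kappa> r))" by (simp add: finite_set_union_pmf finite_set_least)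
  have "measure_pmf.expectation (union_pmf \<kappa> r) (\<lambda>W. avoid (card W) ^ (n - r))
      \<le> measure_pmf.expectation (union_pmf \<kappa> r) (\<lambda>W. indicator {W. card W \<le> U} W + g ^ (n - r))"
  proof (rule expectation_mono_pmf_finite[OF fin])
    fix W assume W: "W \<in> set_pmf (union_pmf \<kappa> r)"
    show "avoid (card W) ^ (n - r) \<le> indicator {W. card W \<le> U} W + g ^ (n - r)"
    proof (cases "card W \<le> U")
      case True
      have "avoid (card W) ^ (n - r) \<le> 1" by (intro power_le_one avoid_nonneg avoid_le_1)
      moreover have "0 \<le> g ^ (n - r)" using assms by simp
      ultimately show ?thesis using True by simp
    next
      case False
      then have "avoid (card W) \<le> g" using card_union_least_le(2)[OF W] by (intro assms) auto
      then show ?thesis using False by (simp add: power_mono avoid_nonneg)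
    qed
  qed
  also have "\<dots> = measure_pmf.prob (union_pmf \<kappa> r) {W. card W \<le> U} + g ^ (n - r)"
    using fin by (subst Bochner_Integration.integral_add) (auto intro: integrable_measure_pmf_finite)
  finally show ?thesis
    unfolding cut_term_def by (simp only: distrib_left[symmetric] mult_left_mono of_nat_0_le_iff)
qed

text \<open>The first three terms are geometric in \<open>r\<close>: they come from the exponential
  moment, from unusually small unions, and from the linear range. The last two do not depend on
  \<open>r\<close>, but are small enough exponentially in \<open>n\<close> to be summed over all
  \<open>r\<close>.\<close>

lemma cut_term_le:
  fixes n :: nat and c \<eta> \<beta> :: real
  defines "c1 \<equiv> a m * (1 - exp (- (1/10)))"
  assumes n: "2 \<le> n" and c: "0 < c" "c * real n \<le> real P" and K1_large: "4 * exp 40 \<le> real (K 1)"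
    and rate: "ln (real n) + \<beta> \<le> real n * edge_rate" "0 \<le> \<beta>"
    and large: "2 * ln (real n) / sqrt (real n) / a m \<le> 1"
      "2 * ln (real n) / sqrt (real n) * (1 + 2 * ln (real n) / a m + exp (ln (real n) / 4)) \<le> 1"
    and \<eta>: "0 < \<eta>" "\<eta> \<le> 1/10" "4 * real P \<le> 9/10 * (\<eta> * real n) * (real (K 1))\<^sup>2"
      "\<And>r. 1 \<le> r \<Longrightarrow> real r \<le> \<eta> * real n \<Longrightarrow> (exp 1 * real n / real r) ^ r \<le> exp (c1 * real n / 4)"
    and r: "r \<in> {1..n div 2}"
  shows "cut_term n r \<le> exp (1 - \<beta>) ^ r + (exp 1 * real (K 1) / c * exp (- real (K 1))) ^ r
    + exp (1 - ln (real n) / 5) ^ r + (exp (- (c1 * real n / 4)) + exp (- real n))"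
    (is "_ \<le> ?A + ?B + ?C + (?D + ?E)")
proof -
  define M where "M = real n * edge_rate"
  \<comment> \<open>The union size guaranteed outside the tail event; the factor 9/10 and the cap
    \<open>exp (- 40) * P\<close> are those of \<open>small_union_term_le\<close>.\<close>
  define y where "y = min (9/10 * (real r * real (K 1))) (exp (- 40) * real P)"
  define U where "U = nat \<lfloor>y\<rfloor>"
  have r1: "1 \<le> r" and rn: "2 * r \<le> n" using r by auto
  have n0: "0 < real n" using n by simp
  have P0: "0 < real P" using P_pos by simp
  have half: "real n / 2 \<le> real (n - r)" using rn by (simp add: of_nat_diff)
  have M: "ln (real n) \<le> M" using rate by (simp add: M_def)
  have y: "0 \<le> y" by (simp add: y_def)
  have U_le: "real U \<le> y" using y by (simp add: U_def)
  have y_le: "y \<le> real u" if "U < u" for u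
    using that unfolding U_def by linarith
  have "(1 :: real) \<le> exp 40" by simp
  with K1_large have K4: "4 \<le> real (K 1)" by linarith
  have "(10 :: real) \<le> exp 40" using exp_ge_add_one_self[of "40 :: real"] by linarith
  with K1_large have K20: "20 \<le> K 1" by linarith
  have c1: "0 \<le> c1" using am_pos by (simp add: c1_def)
  have pos: "0 \<le> ?A" "0 \<le> ?B" "0 \<le> ?C" "0 \<le> ?D" "0 \<le> ?E"
    using c by auto
  have tail: "real (n choose r) * measure_pmf.prob (union_pmf \<kappa> r) {W. card W \<le> U} \<le> ?B"
    using U_le by (intro small_union_term_le r1 c K20) (auto simp: y_def)
  have split: "cut_term n r \<le> ?B + real (n choose r) * g ^ (n - r)"
    if "\<And>u. U < u \<Longrightarrow> u \<le> P \<Longrightarrow> avoid u \<le> g" "0 \<le> g" for g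
  proof -
    have "cut_term n r \<le> real (n choose r) * measure_pmf.prob (union_pmf \<kappa> r) {W. card W \<le> U}
        + real (n choose r) * g ^ (n - r)"
      by (rule cut_term_split_le[OF that])
    then show ?thesis using tail by linarith
  qed
  \<comment> \<open>For small \<open>r\<close> near the threshold the loss of a tenth of the keys would cost a factor
    \<open>n ^ (r / 10)\<close>, so there the exponential moment replaces the split at \<open>U\<close>.\<close>
  consider (small) "M \<le> 2 * ln (real n)" "(real r)\<^sup>2 \<le> real n"
    | (far) "\<eta> * real n < real r"
    | (heavy) "real r \<le> \<eta> * real n" "1/10 \<le> y * real (K m) / real P"
    | (light) "real r \<le> \<eta> * real n" "y * real (K m) / real P < 1/10"
        "2 * ln (real n) < M \<or> real n < (real r)\<^sup>2"
    by linarith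
  then show ?thesis
  proof cases
    case small
    then have "cut_term n r \<le> ?A"
      using K20 rate large n r1 unfolding M_def by (intro cut_term_small_le) auto
    then show ?thesis using pos by linarith
  next
    case far
    \<comment> \<open>For the uncapped \<open>y\<close> this is the hypothesis on
      \<open>\<eta> * n\<close>, for the capped one the size of \<open>K 1\<close>. The constant 4
      suffices: \<open>n - r >= n / 2\<close> turns \<open>exp (- 4)\<close> into
      \<open>exp (- 2 * n)\<close>, against fewer than \<open>exp n\<close> node sets.\<close>
    have y4: "4 * real P \<le> y * real (K 1)"
    proof (cases "9/10 * (real r * real (K 1)) \<le> exp (- 40) * real P")
      case True
      have "9/10 * (\<eta> * real n) * (real (K 1))\<^sup>2 \<le> 9/10 * real r * (real (K 1))\<^sup>2"
        using far by (intro mult_right_mono mult_left_mono) auto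
      with \<eta>(3) show ?thesis using True by (simp add: y_def power2_eq_square)
    next
      case False
      have "4 * real P = exp (- 40) * real P * (4 * exp 40)" by (simp add: exp_minus)
      also have "\<dots> \<le> exp (- 40) * real P * real (K 1)"
        using K1_large by (intro mult_left_mono) auto
      also have "exp (- 40) * real P = y" using False by (simp add: y_def)
      finally show ?thesis .
    qed
    have "avoid u \<le> exp (- 4)" if "U < u" "u \<le> P" for u
    proof -
      have "avoid u \<le> exp (- (y * real (K 1) / real P))"
        using y y_le that by (intro avoid_le_exp_least) auto
      also have "\<dots> \<le> exp (- 4)" using y4 P0 by (simp add: le_divide_eq)
      finally show ?thesis .
    qed
    then have "cut_term n r \<le> ?B + real (n choose r) * exp (- 4) ^ (n - r)"
      by (intro split) auto
    also have "real (n choose r) * exp (- 4) ^ (n - r) \<le> exp (real n) * exp (- 2 * real n)"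
    proof (intro mult_mono)
      have "real (n choose r) \<le> real (2 ^ n)"
        using binomial_le_pow2[of n r] by (simp only: of_nat_le_iff)
      also have "\<dots> \<le> exp 1 ^ n"
        using exp_ge_add_one_self[of "1 :: real"] by (simp add: power_mono)
      finally show "real (n choose r) \<le> exp (real n)" by (simp add: exp_of_nat_mult[symmetric])
      show "exp (- 4) ^ (n - r) \<le> exp (- 2 * real n)"
        using half unfolding exp_of_nat_mult[symmetric] by simp
    qed auto
    also have "exp (real n) * exp (- 2 * real n) = ?E"
      by (simp add: exp_add[symmetric])
    finally show ?thesis using pos by linarith
  next
    case heavy
    \<comment> \<open>With \<open>n - r >= n / 2\<close> the avoidance gives
      \<open>exp (- c1 * n / 2)\<close>; the choice of \<open>\<eta>\<close> keeps
      \<open>n choose r\<close> below the inverse square root of that.\<close>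
    have "cut_term n r \<le> ?B + real (n choose r) * exp (- c1) ^ (n - r)"
      unfolding c1_def using heavy y y_le by (intro split avoid_le_exp_largest) auto
    also have "real (n choose r) * exp (- c1) ^ (n - r) \<le> exp (c1 * real n / 4) * exp (- (c1 * real n / 2))"
    proof (intro mult_mono)
      show "real (n choose r) \<le> exp (c1 * real n / 4)"
        using binomial_le_exp[OF r1, of n] \<eta>(4)[OF r1 heavy(1)] by linarith
      show "exp (- c1) ^ (n - r) \<le> exp (- (c1 * real n / 2))"
        using mult_left_mono[OF half c1] unfolding exp_of_nat_mult[symmetric] by (simp add: mult.commute)
    qed auto
    also have "\<dots> = ?D" by (simp add: exp_add[symmetric])
    finally show ?thesis using pos by linarith
  next
    case light
    \<comment> \<open>The cap is inactive here, because the capped value would make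
      \<open>y * K m / P\<close> at least 4.\<close>
    have y_eq: "y = 9/10 * (real r * real (K 1))"
    proof (rule ccontr)
      assume "y \<noteq> 9/10 * (real r * real (K 1))"
      then have "y = exp (- 40) * real P" by (simp add: y_def split: if_splits)
      then have "y * real (K m) / real P = exp (- 40) * real (K m)" using P0 by simp
      also have "\<dots> \<ge> exp (- 40) * (4 * exp 40)"
        using K1_large K_mono[of 1 m] m by (intro mult_left_mono) auto
      also have "exp (- 40) * (4 * exp 40) = (4 :: real)" by (simp add: exp_minus)
      finally show False using light(2) by linarith
    qed
    \<comment> \<open>Both alternatives halve the entropy cost: \<open>ln n\<close> is below
      \<open>M / 2\<close>, or \<open>r > sqrt n\<close> bounds \<open>n / r\<close> by
      \<open>sqrt n\<close>.\<close>
    have choose: "real (n choose r) \<le> exp (real r * (1 + M / 2))"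
    proof (cases "2 * ln (real n) < M")
      case True
      have "r \<le> n" using rn by simp
      then have "real (n choose r) \<le> real (n ^ r)"
        using binomial_le_pow by (simp only: of_nat_le_iff)
      also have "\<dots> = exp (real r * ln (real n))" using n0 by (simp add: exp_of_nat_mult)
      also have "\<dots> \<le> exp (real r * (1 + M / 2))"
        using True by (intro iffD2[OF exp_le_cancel_iff] mult_left_mono) auto
      finally show ?thesis .
    next
      case False
      with light have "real n < (real r)\<^sup>2" by simp
      then have sq: "sqrt (real n) \<le> real r" by (intro real_le_lsqrt) auto
      have "real n / real r \<le> sqrt (real n)"
      proof -
        have "real n = sqrt (real n) * sqrt (real n)" by simp
        also have "\<dots> \<le> sqrt (real n) * real r" using sq by (intro mult_left_mono) auto
        finally show ?thesis using r1 by (simp add: divide_le_eq)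
      qed
      have "real (n choose r) \<le> (exp 1 * real n / real r) ^ r"
        by (rule binomial_le_exp[OF r1])
      also have "\<dots> \<le> (exp 1 * sqrt (real n)) ^ r"
        using \<open>real n / real r \<le> sqrt (real n)\<close> unfolding times_divide_eq_right[symmetric]
        by (intro power_mono mult_left_mono) auto
      also have "sqrt (real n) = exp (ln (real n) / 2)"
        using n0 by (simp add: ln_sqrt[symmetric])
      also have "(exp 1 * exp (ln (real n) / 2)) ^ r = exp (real r * (1 + ln (real n) / 2))"
        by (simp only: exp_add[symmetric] exp_of_nat_mult)
      also have "\<dots> \<le> exp (real r * (1 + M / 2))"
        using M by (intro iffD2[OF exp_le_cancel_iff] mult_left_mono) auto
      finally show ?thesis .
    qed
    \<comment> \<open>81/100 is the product of 9/10 from the guaranteed keys and 9/10 from the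
      linearization.\<close>
    have "avoid u \<le> exp (- (81/100 * (real r * edge_rate)))" if "U < u" "u \<le> P" for u
    proof -
      have "avoid u \<le> exp (- (y / real (K 1) * edge_rate * (1 - 1/10)))"
        using light y y_le that by (intro avoid_le_exp_edge_rate) auto
      then show ?thesis using K4 by (simp add: y_eq)
    qed
    then have "cut_term n r \<le> ?B + real (n choose r) * exp (- (81/100 * (real r * edge_rate))) ^ (n - r)"
      by (intro split) auto
    also have "real (n choose r) * exp (- (81/100 * (real r * edge_rate))) ^ (n - r)
        \<le> exp (real r * (1 + M / 2)) * exp (- (7/10 * (real r * M)))"
    proof (intro mult_mono choose)
      \<comment> \<open>A third factor 9/10 comes from the \<open>n - r\<close> remaining nodes. The
        total 729/1000 exceeds 7/10, which leaves \<open>M / 5\<close> after the entropy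
        \<open>M / 2\<close>.\<close>
      have "real r \<le> 1/10 * real n"
        using light(1) mult_right_mono[OF \<eta>(2), of "real n"] by simp
      then have "9/10 * real n \<le> real (n - r)" using rn by (simp add: of_nat_diff)
      then have "9/10 * real n * (81/100 * (real r * edge_rate)) \<le> real (n - r) * (81/100 * (real r * edge_rate))"
        using edge_rate_pos by (intro mult_right_mono) auto
      moreover have "9/10 * real n * (81/100 * (real r * edge_rate)) = 729/1000 * (real r * M)"
        by (simp add: M_def)
      moreover have "0 \<le> real r * M" using edge_rate_pos by (simp add: M_def)
      ultimately have "7/10 * (real r * M) \<le> real (n - r) * (81/100 * (real r * edge_rate))"
        by linarith
      then show "exp (- (81/100 * (real r * edge_rate))) ^ (n - r) \<le> exp (- (7/10 * (real r * M)))"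
        unfolding exp_of_nat_mult[symmetric] by simp
    qed auto
    also have "\<dots> = exp (real r * (1 - M / 5))"
      by (simp add: exp_add[symmetric] algebra_simps)
    also have "\<dots> \<le> exp (real r * (1 - ln (real n) / 5))"
      using M by (intro iffD2[OF exp_le_cancel_iff] mult_left_mono) auto
    also have "\<dots> = ?C" by (simp only: exp_of_nat_mult)
    finally show ?thesis using pos by linarith
  qed
qed

end

subsection \<open>The zero law\<close>

text \<open>The second moment bound in terms of \<open>n * b\<close> and \<open>n * b^2\<close>,
  using \<open>1 - b >= exp (- b - 2 * b^2)\<close> for \<open>b <= 1/2\<close>. As
  \<open>n * b = ln n + \<beta>\<close>, the first term is \<open>exp \<beta> / a 1\<close> up to
  the factor \<open>exp (2 * n * b^2)\<close>, and the second is near 1 when \<open>b\<close> and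
  \<open>n * b^2\<close> are small.\<close>

lemma (in het_keys) prob_connected_le_exp:
  assumes n: "2 \<le> n" and "2 * K 1 \<le> P" and b: "b = 1 - avoid (K 1)" "b \<le> 1/2"
  shows "prob_connected n m a K P \<le> exp (real n * b + 2 * (real n * b\<^sup>2) - ln (real n)) / a 1
    + exp (4 * (\<Sum>j = 1..m. 1 / a j) * (real n * b\<^sup>2)) / (1 - b)\<^sup>2 - 1"
proof -
  define A where "A = (\<Sum>j = 1..m. 1 / a j)"
  have A: "0 \<le> A" unfolding A_def using a_pos by (intro sum_nonneg) (auto simp: less_imp_le)
  have b0: "0 \<le> b" using b avoid_le_1 by simp
  have av: "avoid (K 1) = 1 - b" using b by simp
  have a1: "0 < a 1" using a_pos m by auto
  have n0: "0 < real n" using n by simp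
  have "prob_connected n m a K P \<le> 1 / (real n * (a 1 * (1 - b) ^ (n - 1)))
      + avoid (2 * K 1) ^ (n - 2) / (1 - b) ^ (2 * (n - 1)) - 1"
    using prob_connected_le_second_moment[OF n assms(2)] b unfolding av by simp
  also have "1 / (real n * (a 1 * (1 - b) ^ (n - 1))) \<le> exp (real n * b + 2 * (real n * b\<^sup>2) - ln (real n)) / a 1"
  proof -
    have "exp (real n * (- b - 2 * b\<^sup>2)) = exp (- b - 2 * b\<^sup>2) ^ n"
      by (simp only: exp_of_nat_mult)
    also have "\<dots> \<le> (1 - b) ^ n"
    proof (intro power_mono)
      have "exp (- b - 2 * b\<^sup>2) \<le> exp (ln (1 - b))"
        using ln_one_minus_pos_lower_bound[OF b0 b(2)] by (simp only: exp_le_cancel_iff)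
      then show "exp (- b - 2 * b\<^sup>2) \<le> 1 - b" using b by simp
    qed simp
    also have "\<dots> \<le> (1 - b) ^ (n - 1)"
      using b0 b by (intro power_decreasing) auto
    finally have pow: "exp (real n * (- b - 2 * b\<^sup>2)) \<le> (1 - b) ^ (n - 1)" .
    have "exp (- (real n * b + 2 * (real n * b\<^sup>2) - ln (real n)))
        = exp (ln (real n) + real n * (- b - 2 * b\<^sup>2))"
      by (simp add: algebra_simps)
    also have "\<dots> = real n * exp (real n * (- b - 2 * b\<^sup>2))"
      unfolding exp_add using n0 by simp
    also have "\<dots> \<le> real n * (1 - b) ^ (n - 1)"
      using pow by (intro mult_left_mono) auto
    finally have "a 1 * exp (- (real n * b + 2 * (real n * b\<^sup>2) - ln (real n)))
        \<le> a 1 * (real n * (1 - b) ^ (n - 1))"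
      using a1 by (intro mult_left_mono) auto
    then have le: "a 1 * exp (- (real n * b + 2 * (real n * b\<^sup>2) - ln (real n))) \<le> real n * (a 1 * (1 - b) ^ (n - 1))"
      by (simp only: mult.left_commute)
    have "1 / (real n * (a 1 * (1 - b) ^ (n - 1))) \<le> 1 / (a 1 * exp (- (real n * b + 2 * (real n * b\<^sup>2) - ln (real n))))"
      using le a1 by (intro divide_left_mono mult_pos_pos) (use b n0 in auto)
    also have "\<dots> = exp (real n * b + 2 * (real n * b\<^sup>2) - ln (real n)) / a 1"
      by (simp only: exp_minus) (simp add: field_simps)
    finally show ?thesis .
  qed
  also have "avoid (2 * K 1) ^ (n - 2) / (1 - b) ^ (2 * (n - 1)) \<le> exp (4 * A * (real n * b\<^sup>2)) / (1 - b)\<^sup>2"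
  proof -
    have "avoid (2 * K 1) \<le> (1 - b)\<^sup>2 + A * b\<^sup>2"
      using avoid_double_le[OF assms(2)] b by (simp add: A_def)
    also have "A * b\<^sup>2 \<le> (1 - b)\<^sup>2 * (4 * A * b\<^sup>2)"
    proof -
      have "(1/2)\<^sup>2 \<le> (1 - b)\<^sup>2" using b by (intro power_mono) auto
      then have "1 \<le> (1 - b)\<^sup>2 * 4" by (simp add: power_divide)
      then have "1 * (A * b\<^sup>2) \<le> ((1 - b)\<^sup>2 * 4) * (A * b\<^sup>2)"
        using A by (intro mult_right_mono) auto
      then show ?thesis by (simp add: mult_ac)
    qed
    also have "(1 - b)\<^sup>2 + (1 - b)\<^sup>2 * (4 * A * b\<^sup>2) = (1 - b)\<^sup>2 * (1 + 4 * A * b\<^sup>2)"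
      by (simp add: algebra_simps)
    also have "\<dots> \<le> (1 - b)\<^sup>2 * exp (4 * A * b\<^sup>2)"
      by (intro mult_left_mono exp_ge_add_one_self) auto
    finally have "avoid (2 * K 1) \<le> (1 - b)\<^sup>2 * exp (4 * A * b\<^sup>2)" by simp
    then have "avoid (2 * K 1) ^ (n - 2) \<le> ((1 - b)\<^sup>2 * exp (4 * A * b\<^sup>2)) ^ (n - 2)"
      by (intro power_mono avoid_nonneg)
    also have "\<dots> = (1 - b) ^ (2 * (n - 2)) * exp (real (n - 2) * (4 * A * b\<^sup>2))"
      by (simp only: power_mult_distrib power_mult exp_of_nat_mult)
    also have "\<dots> \<le> (1 - b) ^ (2 * (n - 2)) * exp (real n * (4 * A * b\<^sup>2))"
      using b A by (intro mult_left_mono iffD2[OF exp_le_cancel_iff] mult_right_mono) auto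
    finally have "avoid (2 * K 1) ^ (n - 2) / (1 - b) ^ (2 * (n - 1))
        \<le> (1 - b) ^ (2 * (n - 2)) * exp (real n * (4 * A * b\<^sup>2)) / (1 - b) ^ (2 * (n - 1))"
      using b by (intro divide_right_mono) auto
    \<comment> \<open>A pair has \<open>n - 2\<close> outside nodes, whereas two single nodes see
      \<open>n - 1\<close> each; this surplus of 2 leaves the harmless factor
      \<open>1 / (1 - b)^2\<close>.\<close>
    also have exponent: "2 * (n - 1) = 2 * (n - 2) + 2" using n by simp
    also have "(1 - b) ^ (2 * (n - 2)) * exp (real n * (4 * A * b\<^sup>2)) / (1 - b) ^ (2 * (n - 2) + 2)
        = exp (4 * A * (real n * b\<^sup>2)) / (1 - b)\<^sup>2"
      using b by (simp only: power_add) (simp add: mult_ac)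
    finally show ?thesis unfolding exponent .
  qed
  finally show ?thesis by (simp add: A_def)
qed

section \<open>Elementary estimates for the sum of the cut terms\<close>

lemma sum_powers_le:
  fixes x :: real
  assumes "0 \<le> x" "x \<le> 1/2"
  shows "(\<Sum>r = 1..N. x ^ r) \<le> 2 * x"
proof -
  \<comment> \<open>The remainder of the geometric series of ratio 1/2 is added to make the claim
    inductive.\<close>
  have "(\<Sum>r = 1..N. x ^ r) + 2 * x * (1/2) ^ N \<le> 2 * x"
  proof (induction N)
    case (Suc N)
    have "x * x ^ N \<le> x * (1/2) ^ N"
      using assms by (intro mult_left_mono power_mono) auto
    with Suc show ?case by simp
  qed simp
  moreover have "0 \<le> 2 * x * (1/2) ^ N" using assms by simp
  ultimately show ?thesis by linarith
qed

text \<open>With \<open>x = r / n\<close> the left side is \<open>exp (n * x * (1 - ln x))\<close>,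
  and \<open>x * (1 - ln x)\<close> tends to 0 with \<open>x\<close>. The cap 1/10 ensures
  \<open>n - r >= 9/10 * n\<close> later.\<close>

lemma binomial_entropy_threshold:
  fixes d :: real
  assumes "0 < d"
  obtains \<eta> :: real where "0 < \<eta>" "\<eta> \<le> 1/10"
    "\<And>n r :: nat. 1 \<le> r \<Longrightarrow> real r \<le> \<eta> * real n \<Longrightarrow> (exp 1 * real n / real r) ^ r \<le> exp (d * real n)"
proof -
  have "((\<lambda>x :: real. x * (1 - ln x)) \<longlongrightarrow> 0) (at_right 0)"
    by real_asymp
  then have "\<forall>\<^sub>F x in at_right (0 :: real). x * (1 - ln x) < d"
    using assms by (rule order_tendstoD)
  then obtain b where b: "0 < b" "\<And>x. 0 < x \<Longrightarrow> x < b \<Longrightarrow> x * (1 - ln x) < d"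
    unfolding eventually_at_right_field by auto
  show ?thesis
  proof (rule that[of "min (b / 2) (1/10)"])
    fix n r :: nat
    assume r: "1 \<le> r" "real r \<le> min (b / 2) (1/10) * real n"
    then have n: "0 < real n" by (cases n) auto
    define x where "x = real r / real n"
    have x: "0 < x" using r n by (simp add: x_def)
    have "x \<le> min (b / 2) (1/10)" using r n by (simp only: x_def divide_le_eq if_True)
    then have "x * (1 - ln x) < d" using b x by (intro b(2)) auto
    then have "real n * (x * (1 - ln x)) \<le> real n * d" using n by (intro mult_left_mono) auto
    moreover have "exp 1 * real n / real r = exp (1 - ln x)"
      using x n r by (simp add: exp_diff x_def)
    then have "(exp 1 * real n / real r) ^ r = exp (real n * (x * (1 - ln x)))"
      using n by (simp only: exp_of_nat_mult[symmetric]) (simp add: x_def)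
    ultimately show "(exp 1 * real n / real r) ^ r \<le> exp (d * real n)" by (simp add: mult.commute)
  qed (use b in auto)
qed

section \<open>Passage to the limit\<close>

theorem theorem1:
  fixes m :: nat and a :: "nat \<Rightarrow> real"
    and K :: "nat \<Rightarrow> nat \<Rightarrow> nat" and P :: "nat \<Rightarrow> nat" and \<beta> :: "nat \<Rightarrow> real"
  assumes "1 \<le> m"
    and "\<And>i. i \<in> {1..m} \<Longrightarrow> 0 < a i"
    and "(\<Sum>i = 1..m. a i) = 1"
    and "\<And>n i. 1 \<le> n \<Longrightarrow> i \<in> {1..m} \<Longrightarrow> 1 \<le> K i n \<and> K i n \<le> P n"
    and "\<And>n i j. 1 \<le> n \<Longrightarrow> 1 \<le> i \<Longrightarrow> i \<le> j \<Longrightarrow> j \<le> m \<Longrightarrow> K i n \<le> K j n"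
    and "(\<lambda>n. real (P n)) \<in> \<Omega>(\<lambda>n. real n)"
    and "(\<lambda>n. real (K 1 n)) \<in> \<omega>(\<lambda>n. sqrt (real (P n) / real n))"
    and "(\<lambda>n. real (K m n)) \<in> o(\<lambda>n. sqrt (real (P n)))"
    and "\<And>n. 1 \<le> n \<Longrightarrow>
      (\<Sum>j = 1..m. a j * (1 - real ((P n - K 1 n) choose K j n) / real (P n choose K j n)))
        = (ln (real n) + \<beta> n) / real n"
  shows "(filterlim \<beta> at_bot sequentially \<longrightarrow>
           (\<lambda>n. prob_connected n m a (\<lambda>i. K i n) (P n)) \<longlonglongrightarrow> 0) \<and>
         (filterlim \<beta> at_top sequentially \<longrightarrow>
           (\<lambda>n. prob_connected n m a (\<lambda>i. K i n) (P n)) \<longlonglongrightarrow> 1)"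
proof -
  define pc where "pc n = prob_connected n m a (\<lambda>i. K i n) (P n)" for n
  define b where "b n = (ln (real n) + \<beta> n) / real n" for n
  have model: "het_keys m a (\<lambda>i. K i n) (P n)" if "1 \<le> n" for n
    using assms(1-5) that by unfold_locales auto
  have avoid: "1 - het_keys.avoid m a (\<lambda>i. K i n) (P n) (K 1 n) = b n" if n: "1 \<le> n" for n
  proof -
    interpret het_keys m a "\<lambda>i. K i n" "P n" by (rule model[OF n])
    show ?thesis
      using assms(9)[OF n] by (simp add: b_def avoid_def right_diff_distrib sum_subtractf a_sum)
  qed
  have b_nonneg: "0 \<le> b n" if "1 \<le> n" for n
    using avoid[OF that] het_keys.avoid_le_1[OF model[OF that], of "K 1 n"] by simp
  have pc_bounds: "0 \<le> pc n" "pc n \<le> 1" for n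
    by (simp_all add: pc_def prob_connected_def)
  have "pc \<longlonglongrightarrow> 0" if \<beta>: "filterlim \<beta> at_bot sequentially"
  proof -
    define A where "A = (\<Sum>j = 1..m. 1 / a j)"
    have A: "0 \<le> A" unfolding A_def using assms(2) by (intro sum_nonneg) (auto simp: less_imp_le)
    have a1: "0 < a 1" using assms(1,2) by auto
    \<comment> \<open>Once \<open>\<beta> <= 0\<close>, \<open>b <= ln n / n\<close> and hence
      \<open>n * b^2 <= (ln n)^2 / n\<close>. This is eventually at most 1, whence the 2 in the
      first exponent.\<close>
    define g where "g n = exp (\<beta> n + 2) / a 1
      + exp (4 * A * ((ln (real n))\<^sup>2 / real n)) / (1 - ln (real n) / real n)\<^sup>2 - 1" for n
    have "((\<lambda>x. exp (x + 2) / a 1) \<longlongrightarrow> 0) at_bot"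
      using a1 by real_asymp
    then have "(\<lambda>n. exp (\<beta> n + 2) / a 1) \<longlonglongrightarrow> 0"
      using \<beta> by (rule filterlim_compose)
    moreover have "(\<lambda>n. exp (4 * A * ((ln (real n))\<^sup>2 / real n)) / (1 - ln (real n) / real n)\<^sup>2) \<longlonglongrightarrow> 1"
      by real_asymp
    ultimately have "g \<longlonglongrightarrow> 0 + 1 - 1"
      unfolding g_def by (intro tendsto_intros)
    then have g: "g \<longlonglongrightarrow> 0" by simp
    have "\<forall>\<^sub>F n in sequentially. real (K m n) \<le> 1/2 * sqrt (real (P n))"
      using landau_o.smallD[OF assms(8), of "1/2"] by simp
    moreover have "\<forall>\<^sub>F n in sequentially. \<beta> n \<le> 0"
      using \<beta> by (simp add: filterlim_at_bot)
    moreover have "\<forall>\<^sub>F n in sequentially. ln (real n) / real n \<le> 1/2"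
      by real_asymp
    moreover have "\<forall>\<^sub>F n in sequentially. (ln (real n))\<^sup>2 / real n \<le> 1"
      by real_asymp
    moreover have "\<forall>\<^sub>F n in sequentially. 2 \<le> n"
      by (rule eventually_ge_at_top)
    ultimately have "\<forall>\<^sub>F n in sequentially. pc n \<le> g n"
    proof eventually_elim
      case (elim n)
      then have n: "1 \<le> n" by simp
      interpret het_keys m a "\<lambda>i. K i n" "P n" by (rule model[OF n])
      have n0: "0 < real n" using n by simp
      \<comment> \<open>Since \<open>P >= 1\<close>, the bound \<open>K m <= sqrt P / 2\<close>
        implies \<open>2 * K 1 <= P\<close>, so that two disjoint sets of size \<open>K 1\<close>
        fit into the pool.\<close>
      have "sqrt (real (P n)) * 1 \<le> sqrt (real (P n)) * sqrt (real (P n))"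
        using P_pos by (intro mult_left_mono) auto
      then have "sqrt (real (P n)) \<le> real (P n)" by simp
      with elim K_mono[of 1 m] m have small: "2 * K 1 n \<le> P n" by simp
      have bl: "b n \<le> ln (real n) / real n"
        using elim n0 by (simp add: b_def divide_right_mono)
      have bh: "b n \<le> 1/2" using bl elim(3) by (rule order_trans)
      have "real n * (b n)\<^sup>2 \<le> real n * (ln (real n) / real n)\<^sup>2"
        using bl b_nonneg[OF n] n0 by (intro mult_left_mono power_mono) auto
      also have "\<dots> = (ln (real n))\<^sup>2 / real n" using n0 by (simp add: power2_eq_square)
      finally have nb2: "real n * (b n)\<^sup>2 \<le> (ln (real n))\<^sup>2 / real n" .
      have nb: "real n * b n = ln (real n) + \<beta> n" using n0 by (simp add: b_def)
      have "pc n \<le> exp (real n * b n + 2 * (real n * (b n)\<^sup>2) - ln (real n)) / a 1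
          + exp (4 * A * (real n * (b n)\<^sup>2)) / (1 - b n)\<^sup>2 - 1"
        unfolding pc_def A_def using elim small avoid[OF n] bh by (intro prob_connected_le_exp) auto
      also have "exp (real n * b n + 2 * (real n * (b n)\<^sup>2) - ln (real n)) / a 1 \<le> exp (\<beta> n + 2) / a 1"
        using nb order_trans[OF nb2 elim(4)] a1
        by (intro divide_right_mono iffD2[OF exp_le_cancel_iff]) auto
      also have "exp (4 * A * (real n * (b n)\<^sup>2)) / (1 - b n)\<^sup>2
          \<le> exp (4 * A * ((ln (real n))\<^sup>2 / real n)) / (1 - ln (real n) / real n)\<^sup>2"
      proof (intro frac_le iffD2[OF exp_le_cancel_iff] mult_left_mono nb2 power_mono)
        show "0 < (1 - ln (real n) / real n)\<^sup>2" using elim by (intro zero_less_power) auto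
      qed (use A bl elim in auto)
      finally show ?case by (simp add: g_def)
    qed
    then show ?thesis
      using g pc_bounds by (intro tendsto_sandwich[OF _ _ tendsto_const g]) auto
  qed
  moreover have "pc \<longlonglongrightarrow> 1" if \<beta>: "filterlim \<beta> at_top sequentially"
  proof -
    have am: "0 < a m" using assms(1,2) by auto
    obtain c where c: "0 < c" "\<forall>\<^sub>F n in sequentially. c * real n \<le> real (P n)"
      using landau_omega.bigE[OF assms(6)] by auto
    have K1_ge: "\<forall>\<^sub>F n in sequentially. C * sqrt (real (P n) / real n) \<le> real (K 1 n)" if "0 < C" for C
      using landau_omega.smallD[OF assms(7) that] by simp
    \<comment> \<open>\<open>P >= c * n\<close> keeps \<open>sqrt (P / n)\<close> above
      \<open>sqrt c\<close>, and \<open>K 1\<close> outgrows every multiple of it.\<close>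
    have K1_top: "filterlim (\<lambda>n. real (K 1 n)) at_top sequentially"
      unfolding filterlim_at_top_gt[where c = 0]
    proof (intro allI impI)
      fix Z :: real assume Z: "0 < Z"
      have "\<forall>\<^sub>F n in sequentially. Z / sqrt c * sqrt (real (P n) / real n) \<le> real (K 1 n)"
        using Z c by (intro K1_ge) auto
      then show "\<forall>\<^sub>F n in sequentially. Z \<le> real (K 1 n)"
        using c(2) eventually_ge_at_top[of "1 :: nat"]
      proof eventually_elim
        case (elim n)
        then have "sqrt c \<le> sqrt (real (P n) / real n)" by (simp add: le_divide_eq)
        then have "Z / sqrt c * sqrt c \<le> Z / sqrt c * sqrt (real (P n) / real n)"
          using Z c by (intro mult_left_mono) auto
        with elim show ?case using c by simp
      qed
    qed
    define c1 where "c1 = a m * (1 - exp (- (1/10)))"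
    have c1: "0 < c1" using am by (simp add: c1_def)
    then have "0 < c1 / 4" by simp
    from binomial_entropy_threshold[OF this] obtain \<eta> where \<eta>: "0 < \<eta>" "\<eta> \<le> 1/10"
      "\<And>n r :: nat. 1 \<le> r \<Longrightarrow> real r \<le> \<eta> * real n \<Longrightarrow> (exp 1 * real n / real r) ^ r \<le> exp (c1 / 4 * real n)"
      by metis
    \<comment> \<open>The first three serve as ratios of geometric sums, so tending to 0 is enough;
      \<open>fD\<close> occurs in every summand and must beat the factor \<open>n\<close>.\<close>
    define fA fB fC fD where "fA n = exp (1 - \<beta> n)"
      and "fB n = exp 1 * real (K 1 n) / c * exp (- real (K 1 n))"
      and "fC n = exp (1 - ln (real n) / 5)"
      and "fD n = exp (- (c1 * real n / 4)) + exp (- real n)" for n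
    have "((\<lambda>x. exp (1 - x)) \<longlongrightarrow> (0 :: real)) at_top" by real_asymp
    then have fA: "fA \<longlonglongrightarrow> 0" unfolding fA_def using \<beta> by (rule filterlim_compose)
    have "((\<lambda>x. exp 1 * x / c * exp (- x)) \<longlongrightarrow> 0) at_top" using c by real_asymp
    then have fB: "fB \<longlonglongrightarrow> 0" unfolding fB_def using K1_top by (rule filterlim_compose)
    have fC: "fC \<longlonglongrightarrow> 0" unfolding fC_def by real_asymp
    have "(\<lambda>n. real n * exp (- (c1 * real n / 4))) \<longlonglongrightarrow> 0" using c1 by real_asymp
    moreover have "(\<lambda>n. real n * exp (- real n)) \<longlonglongrightarrow> 0" by real_asymp
    ultimately have fD: "(\<lambda>n. real n * fD n) \<longlonglongrightarrow> 0"
      unfolding fD_def distrib_left by (rule tendsto_add_zero)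
    define f where "f n = 2 * fA n + 2 * fB n + 2 * fC n + real n * fD n" for n
    have "f \<longlonglongrightarrow> 2 * 0 + 2 * 0 + 2 * 0 + 0"
      unfolding f_def by (intro tendsto_intros fA fB fC fD)
    then have f: "f \<longlonglongrightarrow> 0" by simp
    have half: "\<forall>\<^sub>F n in sequentially. h n \<le> 1/2" if "h \<longlonglongrightarrow> (0 :: real)" for h
      using order_tendstoD(2)[OF that, of "1/2"] by (rule eventually_mono) auto
    \<comment> \<open>Chosen so that \<open>K 1 >= C * sqrt (P / n)\<close> squares to exactly
      \<open>4 * P <= 9/10 * \<eta> * n * (K 1)^2\<close>, as the case of large \<open>r\<close>
      requires.\<close>
    define C where "C = sqrt (40 / (9 * \<eta>))"
    have C: "0 < C" "C\<^sup>2 = 40 / (9 * \<eta>)" using \<eta> by (auto simp: C_def)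
    have "\<forall>\<^sub>F n in sequentially. C * sqrt (real (P n) / real n) \<le> real (K 1 n)"
      by (rule K1_ge[OF C(1)])
    moreover have "\<forall>\<^sub>F n in sequentially. 4 * exp 40 \<le> real (K 1 n)"
      using K1_top by (simp add: filterlim_at_top)
    moreover have "\<forall>\<^sub>F n in sequentially. 0 \<le> \<beta> n"
      using \<beta> by (simp add: filterlim_at_top)
    moreover have "\<forall>\<^sub>F n in sequentially. 2 * ln (real n) / sqrt (real n) / a m \<le> 1"
      using am by real_asymp
    moreover have "\<forall>\<^sub>F n in sequentially. 2 * ln (real n) / sqrt (real n)
        * (1 + 2 * ln (real n) / a m + exp (ln (real n) / 4)) \<le> 1"
      using am by real_asymp
    moreover have "\<forall>\<^sub>F n in sequentially. 2 \<le> n"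
      by (rule eventually_ge_at_top)
    ultimately have "\<forall>\<^sub>F n in sequentially. 1 - f n \<le> pc n"
      using c(2) half[OF fA] half[OF fB] half[OF fC]
    proof eventually_elim
      case (elim n)
      then have n: "1 \<le> n" by simp
      interpret het_keys m a "\<lambda>i. K i n" "P n" by (rule model[OF n])
      have n0: "0 < real n" using n by simp
      have rate: "ln (real n) + \<beta> n \<le> real n * edge_rate"
        using one_minus_avoid_le avoid[OF n] n0 by (simp add: b_def field_simps)
      have "(C * sqrt (real (P n) / real n))\<^sup>2 \<le> (real (K 1 n))\<^sup>2"
        using elim C by (intro power_mono) auto
      then have "40 / (9 * \<eta>) * (real (P n) / real n) \<le> (real (K 1 n))\<^sup>2"
        by (simp add: power_mult_distrib C(2))
      then have dense: "4 * real (P n) \<le> 9/10 * (\<eta> * real n) * (real (K 1 n))\<^sup>2"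
        using \<eta>(1) n0 by (simp add: field_simps)
      have cut_le: "cut_term n r \<le> fA n ^ r + fB n ^ r + fC n ^ r + fD n" if "r \<in> {1..n div 2}" for r
        unfolding fA_def fB_def fC_def fD_def c1_def
      proof (rule cut_term_le[where \<eta> = \<eta>])
        show "(exp 1 * real n / real r) ^ r \<le> exp (a m * (1 - exp (- (1/10))) * real n / 4)"
          if "1 \<le> r" "real r \<le> \<eta> * real n" for r
          using \<eta>(3)[OF that] by (simp add: c1_def)
      qed (use elim that c(1) rate dense \<eta>(1,2) in auto)
      have "1 - pc n \<le> (\<Sum>r = 1..n div 2. cut_term n r)"
        unfolding pc_def by (rule prob_disconnected_le[OF n])
      also have "\<dots> \<le> (\<Sum>r = 1..n div 2. fA n ^ r + fB n ^ r + fC n ^ r + fD n)"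
        by (intro sum_mono cut_le)
      also have "\<dots> = (\<Sum>r = 1..n div 2. fA n ^ r) + (\<Sum>r = 1..n div 2. fB n ^ r)
          + (\<Sum>r = 1..n div 2. fC n ^ r) + real (n div 2) * fD n"
        by (simp add: sum.distrib)
      also have "\<dots> \<le> 2 * fA n + 2 * fB n + 2 * fC n + real n * fD n"
        using elim c by (intro add_mono sum_powers_le mult_right_mono) (auto simp: fA_def fB_def fC_def fD_def)
      finally show ?case by (simp add: f_def)
    qed
    moreover have "\<forall>\<^sub>F n in sequentially. pc n \<le> 1"
      by (simp add: pc_bounds)
    moreover have "(\<lambda>n. 1 - f n) \<longlonglongrightarrow> 1"
      using tendsto_diff[OF tendsto_const f, of 1] by simp
    ultimately show ?thesis
      by (rule tendsto_sandwich[OF _ _ _ tendsto_const])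
  qed
  ultimately show ?thesis unfolding pc_def[symmetric] by auto
qed

end
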